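(* Let $B$ be a discrete abelian group, $\alpha\in\mathrm{Aut}(B)$, $\hat\alpha\in\mathrm{Aut}(\hat B)$ the dual automorphism, $K=\hat B$, $\mu$ the normalized Haar measure on $K$, and $G=B\rtimes_\alpha\mathbb{Z}$. (1) For $g=(j,b)\in G$, $\chi\in K$ and $f\in L^2(K,\mu)$, the formula $$(U(g)f)(\chi)=\chi(b)f(\hat\alpha^j(\chi))$$ defines a unitary representation $U$ of $G$ on $L^2(K,\mu)$. (2) The representation $U$ in (1) is irreducible if and only if $\hat\alpha$ is ergodic. In particular, $U$ is irreducible when $B=\mathbb{Z}_d[A^{-1}]=\bigcup_{k\ge0}A^{-k}\mathbb{Z}^d$ and $\alpha(b)=Ab$, where $d\in\mathbb{N}$ and $A$ is a $d\times d$ integer matrix with $\det A\ne0$ all of whose eigenvalues $\lambda$ satisfy $|\lambda|>1$.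
   Context: $\hat B$ is the compact Pontryagin dual of $B$; $(\hat\alpha\chi)(b)=\chi(\alpha(b))$. The discrete group $G=B\rtimes_\alpha\mathbb{Z}$ is $\mathbb{Z}\times B$ with product $(j,b)(k,c)=(j+k,\alpha^j(c)+b)$. The automorphism $\hat\alpha$ is called ergodic if the only functions $f\in L^\infty(K)$ with $f\circ\hat\alpha=f$ are the constants, a.e. with respect to $\mu$. The group $\mathbb{Z}_d[A^{-1}]\subset\mathbb{R}^d$ is given the discrete topology. *)

theory Defs
  imports "HOL-Analysis.Analysis" "HOL-Algebra.Coset" "HOL-Algebra.Bij"
begin

section \<open>The dual group and its Haar measure\<close>

definition circle_group :: "complex monoid" where
  "circle_group = \<lparr>carrier = sphere 0 1, mult = (*), one = 1\<rparr>"

text \<open>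
  Since \<open>B\<close> is discrete, all its characters are continuous and the compact-open topology on the
  dual is the topology of pointwise convergence.  Characters are total functions
  \<open>'b \<Rightarrow> complex\<close>, made unique by being extensional outside \<open>carrier B\<close>; the topology of the dual
  is therefore the subspace topology inherited from the product topology, which is the topology of
  the type \<open>'b \<Rightarrow> complex\<close>.
\<close>

definition dual_group :: "('b, 'm) monoid_scheme \<Rightarrow> ('b \<Rightarrow> complex) monoid" where
  "dual_group B =
    \<lparr>carrier = hom B circle_group \<inter> extensional (carrier B),
     mult = (\<lambda>\<phi> \<psi>. \<lambda>b\<in>carrier B. \<phi> b * \<psi> b),
     one = (\<lambda>b\<in>carrier B. 1)\<rparr>"

definition dual_aut :: "('b, 'm) monoid_scheme \<Rightarrow> ('b \<Rightarrow> 'b) \<Rightarrow> ('b \<Rightarrow> complex) \<Rightarrow> ('b \<Rightarrow> complex)"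
  where
  "dual_aut B \<alpha> = (\<lambda>\<phi>\<in>carrier (dual_group B). \<lambda>b\<in>carrier B. \<phi> (\<alpha> b))"

text \<open>
  Normalized Haar measure on a compact Hausdorff group \<open>K\<close> whose carrier is a subspace of a
  topological space: a translation invariant regular Borel probability measure.  The \<open>\<sigma>\<close>-algebra is
  the full Borel \<open>\<sigma>\<close>-algebra, generated by all relatively open sets.  Regularity is not automatic
  here, because \<open>K\<close> need not be metrizable.
\<close>

definition normalized_haar_measure ::
    "('k::topological_space, 'm) monoid_scheme \<Rightarrow> 'k measure \<Rightarrow> bool" where
  "normalized_haar_measure K \<mu> \<longleftrightarrow>
     sets \<mu> = sets (restrict_space borel (carrier K)) \<and>
     emeasure \<mu> (carrier K) = 1 \<and>
     (\<forall>x\<in>carrier K. \<forall>E\<in>sets \<mu>. emeasure \<mu> (x <#\<^bsub>K\<^esub> E) = emeasure \<mu> E) \<and>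
     (\<forall>E\<in>sets \<mu>. emeasure \<mu> E = (SUP C\<in>{C. compact C \<and> C \<subseteq> E}. emeasure \<mu> C)) \<and>
     (\<forall>E\<in>sets \<mu>. emeasure \<mu> E = (INF V\<in>{V. open V \<and> E \<subseteq> V}. emeasure \<mu> (V \<inter> carrier K)))"

text \<open>Membership in \<open>L\<^sup>\<infinity>\<close> means measurable and essentially bounded.\<close>

definition ergodic :: "'k measure \<Rightarrow> ('k \<Rightarrow> 'k) \<Rightarrow> bool" where
  "ergodic M T \<longleftrightarrow>
     (\<forall>f :: 'k \<Rightarrow> complex.
        f \<in> borel_measurable M \<and> (\<exists>C. AE x in M. cmod (f x) \<le> C) \<and>
        (AE x in M. f (T x) = f x)
        \<longrightarrow> (\<exists>c. AE x in M. f x = c))"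


section \<open>The Hilbert space of square integrable functions\<close>

definition square_integrable :: "'k measure \<Rightarrow> ('k \<Rightarrow> complex) set" where
  "square_integrable M =
     {f. f \<in> borel_measurable M \<and> integrable M (\<lambda>x. (cmod (f x))\<^sup>2)}"

definition L2_rel :: "'k measure \<Rightarrow> (('k \<Rightarrow> complex) \<times> ('k \<Rightarrow> complex)) set" where
  "L2_rel M =
     {(f, g). f \<in> square_integrable M \<and> g \<in> square_integrable M \<and> (AE x in M. f x = g x)}"

definition L2 :: "'k measure \<Rightarrow> ('k \<Rightarrow> complex) set set" where
  "L2 M = square_integrable M // L2_rel M"

definition L2_class :: "'k measure \<Rightarrow> ('k \<Rightarrow> complex) \<Rightarrow> ('k \<Rightarrow> complex) set" where
  "L2_class M f = L2_rel M `` {f}"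

text \<open>
  Operations on classes are lifted as in \<^theory>\<open>HOL.Equiv_Relations\<close>, by taking the union of the
  results over all representatives.
\<close>

definition L2_zero :: "'k measure \<Rightarrow> ('k \<Rightarrow> complex) set" where
  "L2_zero M = L2_class M (\<lambda>x. 0)"

definition L2_add ::
    "'k measure \<Rightarrow> ('k \<Rightarrow> complex) set \<Rightarrow> ('k \<Rightarrow> complex) set \<Rightarrow> ('k \<Rightarrow> complex) set" where
  "L2_add M F G = (\<Union>f\<in>F. \<Union>g\<in>G. L2_class M (\<lambda>x. f x + g x))"

definition L2_scale ::
    "'k measure \<Rightarrow> complex \<Rightarrow> ('k \<Rightarrow> complex) set \<Rightarrow> ('k \<Rightarrow> complex) set" where
  "L2_scale M c F = (\<Union>f\<in>F. L2_class M (\<lambda>x. c * f x))"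

definition L2_inner ::
    "'k measure \<Rightarrow> ('k \<Rightarrow> complex) set \<Rightarrow> ('k \<Rightarrow> complex) set \<Rightarrow> complex" where
  "L2_inner M F G = the_elem (\<Union>f\<in>F. \<Union>g\<in>G. {integral\<^sup>L M (\<lambda>x. f x * cnj (g x))})"

definition L2_dist ::
    "'k measure \<Rightarrow> ('k \<Rightarrow> complex) set \<Rightarrow> ('k \<Rightarrow> complex) set \<Rightarrow> real" where
  "L2_dist M F G =
     (let D = L2_add M F (L2_scale M (-1) G) in sqrt (Re (L2_inner M D D)))"

definition L2_closed_subspace :: "'k measure \<Rightarrow> ('k \<Rightarrow> complex) set set \<Rightarrow> bool" where
  "L2_closed_subspace M W \<longleftrightarrow>
     W \<subseteq> L2 M \<and> L2_zero M \<in> W \<and>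
     (\<forall>F\<in>W. \<forall>G\<in>W. L2_add M F G \<in> W) \<and>
     (\<forall>c. \<forall>F\<in>W. L2_scale M c F \<in> W) \<and>
     (\<forall>F\<in>L2 M. (\<forall>e>0. \<exists>G\<in>W. L2_dist M F G < e) \<longrightarrow> F \<in> W)"


section \<open>Unitary representations on \<open>L\<^sup>2\<close>\<close>

definition L2_unitary_group ::
    "'k measure \<Rightarrow> (('k \<Rightarrow> complex) set \<Rightarrow> ('k \<Rightarrow> complex) set) monoid" where
  "L2_unitary_group M =
     BijGroup (L2 M) \<lparr>carrier :=
       {T \<in> Bij (L2 M).
          (\<forall>F\<in>L2 M. \<forall>G\<in>L2 M. T (L2_add M F G) = L2_add M (T F) (T G)) \<and>
          (\<forall>c. \<forall>F\<in>L2 M. T (L2_scale M c F) = L2_scale M c (T F)) \<and>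
          (\<forall>F\<in>L2 M. \<forall>G\<in>L2 M. L2_inner M (T F) (T G) = L2_inner M F G)}\<rparr>"

text \<open>The group \<open>G\<close> is discrete, so no continuity condition appears.\<close>

definition unitary_rep_L2 ::
    "('g, 'm) monoid_scheme \<Rightarrow> 'k measure \<Rightarrow>
     ('g \<Rightarrow> ('k \<Rightarrow> complex) set \<Rightarrow> ('k \<Rightarrow> complex) set) \<Rightarrow> bool" where
  "unitary_rep_L2 G M U \<longleftrightarrow> U \<in> hom G (L2_unitary_group M)"

definition irreducible_rep_L2 ::
    "('g, 'm) monoid_scheme \<Rightarrow> 'k measure \<Rightarrow>
     ('g \<Rightarrow> ('k \<Rightarrow> complex) set \<Rightarrow> ('k \<Rightarrow> complex) set) \<Rightarrow> bool" where
  "irreducible_rep_L2 G M U \<longleftrightarrow>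
     unitary_rep_L2 G M U \<and> L2 M \<noteq> {L2_zero M} \<and>
     (\<forall>W. L2_closed_subspace M W \<and> (\<forall>g\<in>carrier G. U g ` W \<subseteq> W)
          \<longrightarrow> W = {L2_zero M} \<or> W = L2 M)"


section \<open>The semidirect product and its representation\<close>

definition semidirect_int ::
    "('b, 'm) monoid_scheme \<Rightarrow> ('b \<Rightarrow> 'b) \<Rightarrow> (int \<times> 'b) monoid" where
  "semidirect_int B \<alpha> =
    \<lparr>carrier = UNIV \<times> carrier B,
     mult = (\<lambda>(j, b) (k, c). (j + k, (\<alpha> [^]\<^bsub>AutoGroup B\<^esub> j) c \<otimes>\<^bsub>B\<^esub> b)),
     one = (0, \<one>\<^bsub>B\<^esub>)\<rparr>"

definition U_fun ::
    "('b, 'm) monoid_scheme \<Rightarrow> ('b \<Rightarrow> 'b) \<Rightarrow> int \<times> 'b \<Rightarrow>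
     (('b \<Rightarrow> complex) \<Rightarrow> complex) \<Rightarrow> ('b \<Rightarrow> complex) \<Rightarrow> complex" where
  "U_fun B \<alpha> = (\<lambda>(j, b) f \<phi>.
     \<phi> b * f ((dual_aut B \<alpha> [^]\<^bsub>AutoGroup (dual_group B)\<^esub> j) \<phi>))"

definition U_rep ::
    "('b, 'm) monoid_scheme \<Rightarrow> ('b \<Rightarrow> 'b) \<Rightarrow> ('b \<Rightarrow> complex) measure \<Rightarrow> int \<times> 'b \<Rightarrow>
     (('b \<Rightarrow> complex) \<Rightarrow> complex) set \<Rightarrow> (('b \<Rightarrow> complex) \<Rightarrow> complex) set" where
  "U_rep B \<alpha> \<mu> g = (\<lambda>F\<in>L2 \<mu>. \<Union>f\<in>F. L2_class \<mu> (U_fun B \<alpha> g f))"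


section \<open>The groups \<open>\<int>\<^sub>d[A\<^sup>-\<^sup>1]\<close>\<close>

text \<open>
  The dimension \<open>d\<close> is \<open>CARD('n)\<close>.  The power \<open>A\<^sup>-\<^sup>k\<close> is written as an iterated map because \<open>(^)\<close>
  on \<^typ>\<open>real^'n^'n\<close> is the entrywise power.
\<close>

definition int_mat_localization :: "int^'n^'n \<Rightarrow> (real^'n) monoid" where
  "int_mat_localization A =
    \<lparr>carrier = (\<Union>k::nat. (((*v) (matrix_inv (map_matrix real_of_int A))) ^^ k)
                   ` {z. \<forall>i. z $ i \<in> \<int>}),
     mult = (+),
     one = 0\<rparr>"

definition int_mat_aut :: "int^'n^'n \<Rightarrow> real^'n \<Rightarrow> real^'n" where
  "int_mat_aut A = (\<lambda>b\<in>carrier (int_mat_localization A). map_matrix real_of_int A *v b)"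

definition complex_eigenvalue :: "int^'n^'n \<Rightarrow> complex \<Rightarrow> bool" where
  "complex_eigenvalue A l \<longleftrightarrow> (\<exists>v. v \<noteq> 0 \<and> map_matrix of_int A *v v = l *s v)"

end

theory Submission
  imports Defs
begin

text \<open>
  Write \<open>K\<close> for the dual group and \<open>T\<close> for the dual automorphism.

  Unitarity comes down to the invariance of Haar measure under \<open>T\<close>.  The integral of a character
  \<open>\<phi> \<mapsto> \<phi> b\<close> over \<open>K\<close> is 1 if it is constantly 1 and 0 otherwise, by translation invariance, and \<open>T\<close>
  preserves this alternative.  Hence \<open>T\<close> preserves the integrals of trigonometric polynomials.  These
  separate compact sets from closed sets in the manner of Urysohn's lemma, so that regularity
  yields the invariance of the measure of every Borel set (\<open>distr_dual_aut\<close>).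

  If \<open>T\<close> is ergodic, let \<open>W\<close> be an invariant closed subspace.  The operators \<open>U (0, b)\<close> multiply by
  characters.  Every indicator function of a Borel set is an almost everywhere limit of uniformly
  bounded trigonometric polynomials (\<open>indicator_trig_limit\<close>), so \<open>W\<close> is stable under multiplication
  by indicator functions, and then by every measurable function for which the product is square
  integrable.  In particular \<open>W\<close> contains, with \<open>f\<close>, the indicator function of the support of \<open>f\<close>.
  A support \<open>S\<close> of maximal measure contains all others up to null sets
  (\<open>indicator_stable_support\<close>), and applying \<open>U (1, \<one>)\<close> shows that \<open>S\<close> is \<open>T\<close>-invariant up to a null
  set.  If \<open>S\<close> is null then \<open>W = 0\<close>; if it is conull then \<open>W\<close> contains the constant 1 and thus all
  of \<open>L\<^sup>2\<close>.

  Conversely, the functions supported on a \<open>T\<close>-invariant set form an invariant closed subspace, so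
  irreducibility forces invariant sets to be null or conull, and this makes invariant functions
  constant.

  For the group \<open>\<int>\<^sub>d[A\<^sup>-\<^sup>1]\<close> ergodicity holds because only the neutral element has a finite
  \<open>\<alpha>\<close>-orbit.  The Fourier coefficients of an invariant function are constant along the orbits of \<open>\<alpha>\<close>;
  by Bessel's inequality they vanish on infinite orbits, so only the coefficient at the neutral
  element survives (\<open>ergodic_of_infinite_orbits\<close>).  A nonzero \<open>b\<close> with \<open>A\<^sup>n b = b\<close> would give \<open>A\<close> a
  root of unity as an eigenvalue (\<open>periodic_vector_eigenvalue\<close>).  Distinct characters are orthogonal
  since for any \<open>b \<noteq> 0\<close> one of the characters \<open>x \<mapsto> cis (t x\<^sub>i)\<close> is nontrivial at \<open>b\<close>.
\<close>


section \<open>Square integrable functions and their classes\<close>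

lemma square_integrableI:
  assumes "f \<in> borel_measurable M" "integrable M (\<lambda>x. (cmod (f x))\<^sup>2)"
  shows "f \<in> square_integrable M"
  using assms by (simp add: square_integrable_def)

lemma square_integrable_measurable [measurable_dest]:
  "f \<in> square_integrable M \<Longrightarrow> f \<in> borel_measurable M"
  by (simp add: square_integrable_def)

lemma square_integrable_dominated:
  assumes f: "f \<in> square_integrable M" and [measurable]: "g \<in> borel_measurable M"
    and le: "AE x in M. cmod (g x) \<le> C * cmod (f x)"
  shows "g \<in> square_integrable M"
proof (rule square_integrableI)
  have 1: "integrable M (\<lambda>x. C\<^sup>2 * (cmod (f x))\<^sup>2)"
    using f by (simp add: square_integrable_def)
  have 2: "AE x in M. norm ((cmod (g x))\<^sup>2) \<le> norm (C\<^sup>2 * (cmod (f x))\<^sup>2)"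
    using le
  proof eventually_elim
    case (elim x)
    then have "(cmod (g x))\<^sup>2 \<le> (C * cmod (f x))\<^sup>2"
      by (intro power_mono) auto
    then show ?case by (simp add: power_mult_distrib)
  qed
  show "integrable M (\<lambda>x. (cmod (g x))\<^sup>2)"
    by (rule Bochner_Integration.integrable_bound[OF 1 _ 2]) measurable
qed fact

lemma square_integrable_add:
  assumes f: "f \<in> square_integrable M" and g: "g \<in> square_integrable M"
  shows "(\<lambda>x. f x + g x) \<in> square_integrable M"
proof (rule square_integrableI)
  have [measurable]: "f \<in> borel_measurable M" "g \<in> borel_measurable M"
    using f g by (auto simp: square_integrable_def)
  have 1: "integrable M (\<lambda>x. 2 * (cmod (f x))\<^sup>2 + 2 * (cmod (g x))\<^sup>2)"
    using f g by (simp add: square_integrable_def)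
  have 2: "norm ((cmod (f x + g x))\<^sup>2) \<le> norm (2 * (cmod (f x))\<^sup>2 + 2 * (cmod (g x))\<^sup>2)" for x
  proof -
    have "(cmod (f x + g x))\<^sup>2 \<le> (cmod (f x) + cmod (g x))\<^sup>2"
      by (intro power_mono norm_triangle_ineq) auto
    also have "\<dots> \<le> 2 * (cmod (f x))\<^sup>2 + 2 * (cmod (g x))\<^sup>2"
      using sum_squares_bound[of "cmod (f x)" "cmod (g x)"] by (simp add: power2_sum)
    finally show ?thesis by simp
  qed
  show "integrable M (\<lambda>x. (cmod (f x + g x))\<^sup>2)"
    by (rule Bochner_Integration.integrable_bound[OF 1 _ AE_I2[OF 2]]) measurable
  show "(\<lambda>x. f x + g x) \<in> borel_measurable M" by measurable
qed

lemma square_integrable_scale: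
  assumes f: "f \<in> square_integrable M"
  shows "(\<lambda>x. c * f x) \<in> square_integrable M"
  by (rule square_integrable_dominated[OF f, where C = "cmod c"]) (use f in \<open>auto simp: norm_mult\<close>)

lemma square_integrable_diff:
  assumes "f \<in> square_integrable M" "g \<in> square_integrable M"
  shows "(\<lambda>x. f x - g x) \<in> square_integrable M"
  using square_integrable_add[OF assms(1) square_integrable_scale[OF assms(2), of "-1"]] by simp

lemma square_integrable_zero: "(\<lambda>x. 0) \<in> square_integrable M"
  by (simp add: square_integrable_def)

lemma (in finite_measure) square_integrable_bounded:
  assumes [measurable]: "f \<in> borel_measurable M" and "AE x in M. cmod (f x) \<le> C"
  shows "f \<in> square_integrable M"
  by (rule square_integrable_dominated[of "\<lambda>x. 1" _ _ C])
     (use assms in \<open>auto simp: square_integrable_def\<close>)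

lemma integrable_mult_cnj:
  assumes f: "f \<in> square_integrable M" and g: "g \<in> square_integrable M"
  shows "integrable M (\<lambda>x. f x * cnj (g x))"
proof -
  have [measurable]: "f \<in> borel_measurable M" "g \<in> borel_measurable M"
    using f g by (auto simp: square_integrable_def)
  have [measurable]: "(\<lambda>x. cnj (g x)) \<in> borel_measurable M"
    by (rule borel_measurable_continuous_on[of cnj]) (auto intro!: continuous_intros)
  have 1: "integrable M (\<lambda>x. (cmod (f x))\<^sup>2 + (cmod (g x))\<^sup>2)"
    using f g by (simp add: square_integrable_def)
  have 2: "norm (f x * cnj (g x)) \<le> norm ((cmod (f x))\<^sup>2 + (cmod (g x))\<^sup>2)" for x
  proof -
    have "2 * (cmod (f x) * cmod (g x)) \<le> (cmod (f x))\<^sup>2 + (cmod (g x))\<^sup>2"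
      using sum_squares_bound[of "cmod (f x)" "cmod (g x)"] by simp
    moreover have "0 \<le> cmod (f x) * cmod (g x)" by simp
    ultimately show ?thesis unfolding norm_mult complex_mod_cnj real_norm_def by linarith
  qed
  show ?thesis
    by (rule Bochner_Integration.integrable_bound[OF 1 _ AE_I2[OF 2]]) measurable
qed

lemma equiv_L2_rel: "equiv (square_integrable M) (L2_rel M)"
proof (rule equivI)
  show "sym (L2_rel M)" by (rule symI) (auto simp: L2_rel_def)
  show "trans (L2_rel M)" by (rule transI) (auto simp: L2_rel_def)
  show "L2_rel M \<subseteq> square_integrable M \<times> square_integrable M" by (auto simp: L2_rel_def)
  show "refl_on (square_integrable M) (L2_rel M)"
    by (rule refl_onI) (auto simp: L2_rel_def)
qed

lemma L2_class_in_L2: "f \<in> square_integrable M \<Longrightarrow> L2_class M f \<in> L2 M"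
  by (simp add: L2_class_def L2_def quotientI)

lemma L2_cases:
  assumes "F \<in> L2 M"
  obtains f where "f \<in> square_integrable M" "F = L2_class M f"
  using assms by (auto simp: L2_def L2_class_def elim: quotientE)

lemma mem_L2_class:
  "f \<in> square_integrable M \<Longrightarrow>
     g \<in> L2_class M f \<longleftrightarrow> g \<in> square_integrable M \<and> (AE x in M. f x = g x)"
  by (auto simp: L2_class_def L2_rel_def)

lemma L2_class_eq_iff:
  assumes "f \<in> square_integrable M" "g \<in> square_integrable M"
  shows "L2_class M f = L2_class M g \<longleftrightarrow> (AE x in M. f x = g x)"
  unfolding L2_class_def eq_equiv_class_iff[OF equiv_L2_rel assms] using assms
  by (simp add: L2_rel_def)

text \<open>
  An operation on functions that respects almost everywhere equality is computed on classes by any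
  choice of representatives, because the union over all representatives is a union of equal classes.
\<close>

lemma L2_lift:
  assumes f: "f \<in> square_integrable M"
    and S: "\<And>f'. f' \<in> square_integrable M \<Longrightarrow> (AE x in M. f x = f' x) \<Longrightarrow> S f' = S f"
  shows "(\<Union>f'\<in>L2_class M f. S f') = S f"
proof -
  have "(\<Union>f'\<in>L2_class M f. S f') = (\<Union>f'\<in>L2_class M f. S f)"
    by (intro SUP_cong refl S) (simp_all add: mem_L2_class[OF f])
  moreover have "f \<in> L2_class M f" by (simp add: mem_L2_class[OF f] f)
  ultimately show ?thesis by auto
qed

lemma L2_lift2:
  assumes f: "f \<in> square_integrable M" and g: "g \<in> square_integrable M"
    and S: "\<And>f' g'. f' \<in> square_integrable M \<Longrightarrow> (AE x in M. f x = f' x) \<Longrightarrow>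
              g' \<in> square_integrable M \<Longrightarrow> (AE x in M. g x = g' x) \<Longrightarrow> S f' g' = S f g"
  shows "(\<Union>f'\<in>L2_class M f. \<Union>g'\<in>L2_class M g. S f' g') = S f g"
proof -
  have "(\<Union>g'\<in>L2_class M g. S f' g') = S f g"
    if f': "f' \<in> square_integrable M" "AE x in M. f x = f' x" for f'
  proof -
    have "S f' g' = S f' g" if "g' \<in> square_integrable M" "AE x in M. g x = g' x" for g'
      using S[OF f' that] S[OF f' g] by simp
    then have "(\<Union>g'\<in>L2_class M g. S f' g') = S f' g" by (rule L2_lift[OF g])
    with S[OF f' g] show ?thesis by simp
  qed
  moreover have "(\<Union>g'\<in>L2_class M g. S f g') = S f g"
    by (rule L2_lift[OF g]) (use S[OF f] in simp)
  ultimately show ?thesis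
    using L2_lift[OF f, of "\<lambda>f'. \<Union>g'\<in>L2_class M g. S f' g'"] by simp
qed

lemma L2_add_class:
  assumes f: "f \<in> square_integrable M" and g: "g \<in> square_integrable M"
  shows "L2_add M (L2_class M f) (L2_class M g) = L2_class M (\<lambda>x. f x + g x)"
  unfolding L2_add_def
proof (rule L2_lift2[OF f g], subst L2_class_eq_iff)
  fix f' g'
  assume "f' \<in> square_integrable M" "g' \<in> square_integrable M"
    and eq: "AE x in M. f x = f' x" "AE x in M. g x = g' x"
  from eq show "AE x in M. f' x + g' x = f x + g x" by eventually_elim simp
qed (assumption | rule square_integrable_add f g)+

lemma L2_scale_class:
  assumes f: "f \<in> square_integrable M"
  shows "L2_scale M c (L2_class M f) = L2_class M (\<lambda>x. c * f x)"
  unfolding L2_scale_def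
proof (rule L2_lift[OF f], subst L2_class_eq_iff)
  fix f' assume f': "f' \<in> square_integrable M" "AE x in M. f x = f' x"
  from f'(2) show "AE x in M. c * f' x = c * f x" by eventually_elim simp
qed (assumption | rule square_integrable_scale f)+

lemma L2_inner_class:
  assumes f: "f \<in> square_integrable M" and g: "g \<in> square_integrable M"
  shows "L2_inner M (L2_class M f) (L2_class M g) = (\<integral>x. f x * cnj (g x) \<partial>M)"
proof -
  have "(\<integral>x. f' x * cnj (g' x) \<partial>M) = (\<integral>x. f x * cnj (g x) \<partial>M)"
    if "f' \<in> square_integrable M" "AE x in M. f x = f' x"
      "g' \<in> square_integrable M" "AE x in M. g x = g' x" for f' g'
  proof (rule integral_cong_AE)
    show "AE x in M. f' x * cnj (g' x) = f x * cnj (g x)"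
      using that(2,4) by eventually_elim simp
  qed (intro borel_measurable_integrable integrable_mult_cnj that f g)+
  then have "(\<Union>f'\<in>L2_class M f. \<Union>g'\<in>L2_class M g. {\<integral>x. f' x * cnj (g' x) \<partial>M})
      = {\<integral>x. f x * cnj (g x) \<partial>M}"
    by (intro L2_lift2 f g) simp
  then show ?thesis by (simp add: L2_inner_def)
qed

lemma L2_dist_class:
  assumes f: "f \<in> square_integrable M" and g: "g \<in> square_integrable M"
  shows "L2_dist M (L2_class M f) (L2_class M g) = sqrt (\<integral>x. (cmod (f x - g x))\<^sup>2 \<partial>M)"
proof -
  have d: "(\<lambda>x. f x - g x) \<in> square_integrable M" by (rule square_integrable_diff[OF f g])
  have "L2_add M (L2_class M f) (L2_scale M (-1) (L2_class M g)) = L2_class M (\<lambda>x. f x - g x)"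
    unfolding L2_scale_class[OF g] L2_add_class[OF f square_integrable_scale[OF g]] by simp
  moreover have "(\<integral>x. (f x - g x) * cnj (f x - g x) \<partial>M) = of_real (\<integral>x. (cmod (f x - g x))\<^sup>2 \<partial>M)"
    unfolding complex_norm_square[symmetric] by (rule integral_complex_of_real)
  ultimately show ?thesis
    unfolding L2_dist_def Let_def by (simp only: L2_inner_class[OF d d]) simp
qed

lemma L2_class_eq_zero_iff:
  "f \<in> square_integrable M \<Longrightarrow> L2_class M f = L2_zero M \<longleftrightarrow> (AE x in M. f x = 0)"
  by (simp add: L2_zero_def L2_class_eq_iff square_integrable_zero)


section \<open>Closed subspaces stable under multiplication operators\<close>

text \<open>
  Dominated convergence is the only source of convergence in the \<open>L\<^sup>2\<close> metric that is needed: a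
  closed subspace contains every almost everywhere limit of a dominated sequence of its elements.
\<close>

lemma closed_subspace_dominated_limit:
  assumes W: "L2_closed_subspace M W"
    and mem: "\<And>n. L2_class M (s n) \<in> W" and s[measurable]: "\<And>n. s n \<in> borel_measurable M"
    and g: "g \<in> square_integrable M" and [measurable]: "f \<in> borel_measurable M"
    and lim: "AE x in M. (\<lambda>n. s n x) \<longlonglongrightarrow> f x"
    and dom: "\<And>n. AE x in M. cmod (s n x) \<le> C * cmod (g x)"
  shows "L2_class M f \<in> W"
proof -
  have s2: "s n \<in> square_integrable M" for n
    by (rule square_integrable_dominated[OF g s dom])
  have "AE x in M. \<forall>n. cmod (s n x) \<le> C * cmod (g x)"
    unfolding AE_all_countable using dom by simp
  with lim have domf: "AE x in M. cmod (f x) \<le> C * cmod (g x)"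
  proof eventually_elim
    case (elim x)
    then show ?case
      by (intro tendsto_upperbound[OF tendsto_norm[OF elim(1)]]) auto
  qed
  have f2: "f \<in> square_integrable M"
    by (rule square_integrable_dominated[OF g _ domf]) measurable
  have g2: "integrable M (\<lambda>x. 4 * C\<^sup>2 * (cmod (g x))\<^sup>2)"
    using g by (simp add: square_integrable_def)
  note [measurable] = g
  have "(\<lambda>n. \<integral>x. (cmod (f x - s n x))\<^sup>2 \<partial>M) \<longlonglongrightarrow> (\<integral>x. 0 \<partial>M)"
  proof (rule integral_dominated_convergence[OF _ _ g2])
    show "AE x in M. (\<lambda>n. (cmod (f x - s n x))\<^sup>2) \<longlonglongrightarrow> 0"
      using lim
    proof eventually_elim
      case (elim x)
      have "(\<lambda>n. (cmod (f x - s n x))\<^sup>2) \<longlonglongrightarrow> (cmod (f x - f x))\<^sup>2"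
        by (intro tendsto_intros elim)
      then show ?case by simp
    qed
    show "AE x in M. norm ((cmod (f x - s n x))\<^sup>2) \<le> 4 * C\<^sup>2 * (cmod (g x))\<^sup>2" for n
      using dom[of n] domf
    proof eventually_elim
      case (elim x)
      then have "cmod (f x - s n x) \<le> 2 * C * cmod (g x)"
        using norm_triangle_ineq4[of "f x" "s n x"] by linarith
      then have "(cmod (f x - s n x))\<^sup>2 \<le> (2 * C * cmod (g x))\<^sup>2"
        by (intro power_mono) auto
      then show ?case by (simp add: power_mult_distrib)
    qed
  qed measurable
  then have "(\<lambda>n. sqrt (\<integral>x. (cmod (f x - s n x))\<^sup>2 \<partial>M)) \<longlonglongrightarrow> sqrt 0"
    by (intro tendsto_real_sqrt) simp
  then have "(\<lambda>n. L2_dist M (L2_class M f) (L2_class M (s n))) \<longlonglongrightarrow> 0"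
    by (simp add: L2_dist_class f2 s2)
  then have "\<exists>n. L2_dist M (L2_class M f) (L2_class M (s n)) < e" if "e > 0" for e
    using order_tendstoD(2)[OF _ that] eventually_happens' sequentially_bot by blast
  then have "\<exists>G\<in>W. L2_dist M (L2_class M f) G < e" if "e > 0" for e
    using mem that by blast
  then show ?thesis
    using W L2_class_in_L2[OF f2] by (auto simp: L2_closed_subspace_def)
qed

lemma closed_subspace_add:
  assumes "L2_closed_subspace M W" "L2_class M f \<in> W" "L2_class M g \<in> W"
    "f \<in> square_integrable M" "g \<in> square_integrable M"
  shows "L2_class M (\<lambda>x. f x + g x) \<in> W"
  using assms unfolding L2_closed_subspace_def by (metis L2_add_class)

lemma closed_subspace_scale:
  assumes "L2_closed_subspace M W" "L2_class M f \<in> W" "f \<in> square_integrable M"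
  shows "L2_class M (\<lambda>x. c * f x) \<in> W"
  using assms unfolding L2_closed_subspace_def by (metis L2_scale_class)

lemma closed_subspace_zero: "L2_closed_subspace M W \<Longrightarrow> L2_class M (\<lambda>x. 0) \<in> W"
  by (simp add: L2_closed_subspace_def L2_zero_def)

lemma closed_subspace_sum:
  assumes W: "L2_closed_subspace M W" and "finite I"
    and "\<And>i. i \<in> I \<Longrightarrow> L2_class M (f i) \<in> W" "\<And>i. i \<in> I \<Longrightarrow> f i \<in> square_integrable M"
  shows "L2_class M (\<lambda>x. \<Sum>i\<in>I. f i x) \<in> W \<and> (\<lambda>x. \<Sum>i\<in>I. f i x) \<in> square_integrable M"
  using assms(2-)
  by (induction I rule: finite_induct)
     (auto simp: closed_subspace_zero[OF W] square_integrable_zero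
           intro!: closed_subspace_add[OF W] square_integrable_add)

lemma closed_subspace_cong:
  assumes "L2_class M f \<in> W" "f \<in> square_integrable M" "g \<in> square_integrable M"
    "AE x in M. f x = g x"
  shows "L2_class M g \<in> W"
  using assms L2_class_eq_iff by metis

text \<open>
  Stability is only asked for multiplication by indicator functions, because these are what the
  approximation of Borel sets by trigonometric polynomials delivers; \<open>indicator_stable_mult\<close>
  extends it to all multipliers for which the product is square integrable.
\<close>

definition indicator_stable :: "'k measure \<Rightarrow> ('k \<Rightarrow> complex) set set \<Rightarrow> bool" where
  "indicator_stable M W \<longleftrightarrow> L2_closed_subspace M W \<and>
     (\<forall>E\<in>sets M. \<forall>f\<in>square_integrable M.
        L2_class M f \<in> W \<longrightarrow> L2_class M (\<lambda>x. indicator E x * f x) \<in> W)"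

text \<open>
  Multipliers need not be bounded: approximating \<open>g\<close> by simple functions \<open>s\<^sub>n\<close> with
  \<open>\<bar>s\<^sub>n\<bar> \<le> 2 \<bar>g\<bar>\<close>, the products \<open>s\<^sub>n f\<close> are dominated by \<open>2 \<bar>g f\<bar>\<close>.  The use of this is the choice
  \<open>g = 1/f\<close> below.
\<close>

lemma indicator_stable_mult:
  assumes W: "indicator_stable M W" and f: "f \<in> square_integrable M" "L2_class M f \<in> W"
    and g[measurable]: "g \<in> borel_measurable M" and gf: "(\<lambda>x. g x * f x) \<in> square_integrable M"
  shows "L2_class M (\<lambda>x. g x * f x) \<in> W"
proof -
  note [measurable] = f(1)
  have cl: "L2_closed_subspace M W" using W by (simp add: indicator_stable_def)
  obtain s where s: "\<And>n. simple_function M (s n)"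
    and slim: "\<And>x. x \<in> space M \<Longrightarrow> (\<lambda>n. s n x) \<longlonglongrightarrow> g x"
    and sdom: "\<And>n x. x \<in> space M \<Longrightarrow> dist (s n x) 0 \<le> 2 * dist (g x) 0"
    using borel_measurable_implies_sequence_metric[OF g, of 0] by metis
  have [measurable]: "s n \<in> borel_measurable M" for n
    using s by (rule borel_measurable_simple_function)
  have ind: "(\<lambda>x. indicator E x * f x) \<in> square_integrable M" if "E \<in> sets M" for E
    by (rule square_integrable_dominated[OF f(1), where C = 1])
       (use that in \<open>auto simp: indicator_def\<close>)
  have step: "L2_class M (\<lambda>x. s n x * f x) \<in> W" for n
  proof -
    let ?E = "\<lambda>y. s n -` {y} \<inter> space M"
    have E: "?E y \<in> sets M" for y using s by (rule simple_functionD)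
    have "L2_class M (\<lambda>x. y * (indicator (?E y) x * f x)) \<in> W" for y
      by (rule closed_subspace_scale[OF cl _ ind[OF E]])
         (use W f E in \<open>auto simp: indicator_stable_def\<close>)
    then have *: "L2_class M (\<lambda>x. \<Sum>y\<in>s n ` space M. y * (indicator (?E y) x * f x)) \<in> W \<and>
      (\<lambda>x. \<Sum>y\<in>s n ` space M. y * (indicator (?E y) x * f x)) \<in> square_integrable M"
      by (intro closed_subspace_sum[OF cl] square_integrable_scale ind E)
         (auto intro: simple_functionD(1)[OF s])
    have eq: "(\<Sum>y\<in>s n ` space M. y * (indicator (?E y) x * f x)) = s n x * f x"
      if "x \<in> space M" for x
    proof -
      have "(\<Sum>y\<in>s n ` space M. y * (indicator (?E y) x * f x))
          = (\<Sum>y\<in>s n ` space M. if s n x = y then y * f x else 0)"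
        using that by (intro sum.cong) (auto simp: indicator_def)
      then show ?thesis
        using that simple_functionD(1)[OF s] by (simp add: sum.delta)
    qed
    have "(\<lambda>x. s n x * f x) \<in> square_integrable M"
      by (rule square_integrable_dominated[OF conjunct2[OF *], where C = 1])
         (auto simp: eq)
    then show ?thesis
      by (rule closed_subspace_cong[OF conjunct1[OF *] conjunct2[OF *]]) (auto simp: eq)
  qed
  show ?thesis
  proof (rule closed_subspace_dominated_limit[OF cl step _ gf])
    show "AE x in M. (\<lambda>n. s n x * f x) \<longlonglongrightarrow> g x * f x"
      by (auto intro!: tendsto_intros slim)
    show "AE x in M. cmod (s n x * f x) \<le> 2 * cmod (g x * f x)" for n
    proof (rule AE_I2)
      fix x assume "x \<in> space M"
      from sdom[OF this, of n] have "cmod (s n x) \<le> 2 * cmod (g x)" by simp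
      from mult_right_mono[OF this, of "cmod (f x)"]
      show "cmod (s n x * f x) \<le> 2 * cmod (g x * f x)" by (simp add: norm_mult)
    qed
  qed measurable
qed

context finite_measure
begin

lemma indicator_square_integrable: "E \<in> sets M \<Longrightarrow> indicator E \<in> square_integrable M"
  by (rule square_integrable_bounded[of _ 1]) (auto simp: indicator_def)

text \<open>
  The supports of the elements of \<open>W\<close> are closed under countable unions, hence one of them has the
  largest measure, and this one contains all others up to null sets.  This is Wiener's description of
  such subspaces by the set on which their elements live.
\<close>

lemma indicator_stable_support:
  assumes W: "indicator_stable M W"
  obtains U where "U \<in> sets M" "L2_class M (indicator U) \<in> W"
    "\<And>f. f \<in> square_integrable M \<Longrightarrow> L2_class M f \<in> W \<Longrightarrow> AE x in M. x \<notin> U \<longrightarrow> f x = 0"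
proof -
  have cl: "L2_closed_subspace M W" using W by (simp add: indicator_stable_def)
  define \<E> where "\<E> = {E\<in>sets M. L2_class M (indicator E) \<in> W}"
  have un: "E \<union> F \<in> \<E>" if "E \<in> \<E>" "F \<in> \<E>" for E F
  proof -
    have EF[measurable]: "E \<in> sets M" "F \<in> sets M" using that by (auto simp: \<E>_def)
    have W': "L2_class M (indicator E) \<in> W" "L2_class M (indicator F) \<in> W"
      using that by (auto simp: \<E>_def)
    have "space M - E \<in> sets M" by measurable
    with W W'(2) indicator_square_integrable[OF EF(2)]
    have 2: "L2_class M (\<lambda>x. indicator (space M - E) x * indicator F x) \<in> W"
      by (auto simp only: indicator_stable_def)
    have "(\<lambda>x. indicator (space M - E) x * indicator F x) \<in> square_integrable M"
      by (rule square_integrable_bounded[of _ 1]) (measurable, auto simp: indicator_def)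
    from closed_subspace_add[OF cl W'(1) 2 indicator_square_integrable[OF EF(1)] this]
    have "L2_class M (\<lambda>x. indicator E x + indicator (space M - E) x * indicator F x) \<in> W" .
    then have "L2_class M (indicator (E \<union> F)) \<in> W"
      by (rule closed_subspace_cong)
         (auto intro!: indicator_square_integrable square_integrable_bounded[of _ 2]
               simp: indicator_def)
    then show ?thesis by (auto simp: \<E>_def)
  qed
  have ne: "{} \<in> \<E>"
    using closed_subspace_zero[OF cl] by (auto simp: \<E>_def indicator_def[abs_def])
  define s where "s = (SUP E\<in>\<E>. measure M E)"
  have bdd: "bdd_above (measure M ` \<E>)"
    by (rule bdd_aboveI2[of _ _ "measure M (space M)"]) (auto simp: bounded_measure)
  have le_s: "measure M E \<le> s" if "E \<in> \<E>" for E
    unfolding s_def by (rule cSUP_upper[OF that bdd])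
  have "\<exists>E\<in>\<E>. measure M E > s - inverse (real (Suc n))" for n
  proof -
    have "s - inverse (real (Suc n)) < s" by simp
    then show ?thesis
      unfolding s_def using less_cSUP_iff[OF _ bdd] ne by blast
  qed
  then obtain D where D: "\<And>n. D n \<in> \<E>" "\<And>n. measure M (D n) > s - inverse (real (Suc n))"
    by metis
  define U where "U = (\<Union>n. D n)"
  have Dm[measurable]: "D n \<in> sets M" for n using D by (auto simp: \<E>_def)
  have fin: "(\<Union>i<n. D i) \<in> \<E>" for n
    by (induction n) (auto simp: ne lessThan_Suc D intro: un)
  have "L2_class M (indicator U) \<in> W"
  proof (rule closed_subspace_dominated_limit[OF cl, where s = "\<lambda>n. indicator (\<Union>i<n. D i)"
        and g = "\<lambda>x. 1" and C = 1])
    show "L2_class M (indicator (\<Union>i<n. D i)) \<in> W" for n using fin by (auto simp: \<E>_def)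
    show "AE x in M. (\<lambda>n. indicator (\<Union>i<n. D i) x :: complex) \<longlonglongrightarrow> indicator U x"
      unfolding U_def by (simp add: LIMSEQ_indicator_UN)
  qed (auto simp: U_def indicator_def intro!: square_integrable_bounded[of _ 1])
  then have U: "U \<in> \<E>" by (auto simp: \<E>_def U_def)
  have sU: "s \<le> measure M U"
  proof (rule field_le_epsilon)
    fix e :: real assume "e > 0"
    then obtain n where "inverse (real (Suc n)) < e" using reals_Archimedean by blast
    moreover have "measure M (D n) \<le> measure M U"
      using U by (intro finite_measure_mono) (auto simp: U_def \<E>_def)
    ultimately show "s \<le> measure M U + e" using D(2)[of n] by linarith
  qed
  show ?thesis
  proof (rule that[of U])
    show Us[measurable]: "U \<in> sets M" "L2_class M (indicator U) \<in> W" using U by (auto simp: \<E>_def)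
    fix f assume f: "f \<in> square_integrable M" "L2_class M f \<in> W"
    note [measurable] = f(1)
    define E where "E = {x\<in>space M. f x \<noteq> 0}"
    have [measurable]: "E \<in> sets M" unfolding E_def by measurable
    \<comment> \<open>Dividing \<open>f\<close> by itself gives the indicator function of its support, as \<open>inverse 0 = 0\<close>.\<close>
    have "L2_class M (\<lambda>x. inverse (f x) * f x) \<in> W"
      by (rule indicator_stable_mult[OF W f])
         (auto intro!: square_integrable_bounded[of _ 1] simp: norm_mult norm_inverse field_simps)
    then have "L2_class M (indicator E) \<in> W"
      by (rule closed_subspace_cong)
         (auto intro!: square_integrable_bounded[of _ 1]
               simp: norm_mult norm_inverse field_simps E_def indicator_def)
    then have "E \<in> \<E>" by (auto simp: \<E>_def)
    then have "measure M (U \<union> E) \<le> measure M U"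
      using le_s[OF un[OF U]] sU by force
    moreover have "measure M (U \<union> E) = measure M U + measure M (E - U)"
      by (subst finite_measure_Union[symmetric]) auto
    ultimately have "measure M (E - U) = 0" by (simp add: measure_le_0_iff)
    then have "AE x in M. x \<notin> E - U"
      by (intro AE_not_in) (auto simp: null_sets_def emeasure_eq_measure)
    then show "AE x in M. x \<notin> U \<longrightarrow> f x = 0"
      by (rule AE_mp) (auto simp: E_def)
  qed
qed

end

lemma (in finite_measure) indicator_stable_eq_L2:
  assumes W: "indicator_stable M W" and one: "L2_class M (\<lambda>x. 1) \<in> W"
  shows "W = L2 M"
proof
  show "W \<subseteq> L2 M" using W by (simp add: indicator_stable_def L2_closed_subspace_def)
  show "L2 M \<subseteq> W"
  proof
    fix F assume "F \<in> L2 M"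
    then obtain f where f: "f \<in> square_integrable M" "F = L2_class M f" by (rule L2_cases)
    have "L2_class M (\<lambda>x. f x * 1) \<in> W"
      by (rule indicator_stable_mult[OF W _ one])
         (use f in \<open>auto intro!: square_integrable_bounded[of _ 1]\<close>)
    then show "F \<in> W" using f by simp
  qed
qed


section \<open>Separation and compactness in product spaces\<close>

text \<open>
  The weaker separation classes come first: their arities for the function type have to be at least
  as general as the one for \<^class>\<open>t2_space\<close>.  Hausdorffness makes the Stone--Weierstrass lemmas
  applicable to the dual group.
\<close>

instance "fun" :: (type, t0_space) t0_space
proof
  fix f g :: "'a \<Rightarrow> 'b" assume "f \<noteq> g"
  then obtain x where "f x \<noteq> g x" by blast
  then obtain U where U: "open U" "\<not> (f x \<in> U \<longleftrightarrow> g x \<in> U)"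
    using separation_t0 by metis
  have "continuous_on UNIV (\<lambda>h::'a \<Rightarrow> 'b. h x)" by simp
  then have "open ((\<lambda>h::'a \<Rightarrow> 'b. h x) -` U)"
    by (rule open_vimage[OF U(1)])
  then show "\<exists>U. open U \<and> \<not> (f \<in> U \<longleftrightarrow> g \<in> U)"
    using U by (intro exI[of _ "(\<lambda>h. h x) -` U"]) auto
qed

instance "fun" :: (type, t1_space) t1_space
proof
  fix f g :: "'a \<Rightarrow> 'b" assume "f \<noteq> g"
  then obtain x where "f x \<noteq> g x" by blast
  then obtain U where U: "open U" "f x \<in> U" "g x \<notin> U"
    using t1_space by metis
  have "continuous_on UNIV (\<lambda>h::'a \<Rightarrow> 'b. h x)" by simp
  then have "open ((\<lambda>h::'a \<Rightarrow> 'b. h x) -` U)"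
    by (rule open_vimage[OF U(1)])
  then show "\<exists>U. open U \<and> f \<in> U \<and> g \<notin> U"
    using U by (intro exI[of _ "(\<lambda>h. h x) -` U"]) auto
qed

instance "fun" :: (type, t2_space) t2_space
proof
  fix f g :: "'a \<Rightarrow> 'b" assume "f \<noteq> g"
  then obtain x where "f x \<noteq> g x" by blast
  then obtain U V where UV: "open U" "open V" "f x \<in> U" "g x \<in> V" "U \<inter> V = {}"
    using hausdorff by metis
  have c: "continuous_on UNIV (\<lambda>h::'a \<Rightarrow> 'b. h x)" by simp
  show "\<exists>U V. open U \<and> open V \<and> f \<in> U \<and> g \<in> V \<and> U \<inter> V = {}"
    using UV open_vimage[OF UV(1) c] open_vimage[OF UV(2) c]
    by (intro exI[of _ "(\<lambda>h. h x) -` U"] exI[of _ "(\<lambda>h. h x) -` V"]) auto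
qed

lemma compact_PiE_UNIV:
  fixes S :: "'a \<Rightarrow> 'b::topological_space set"
  assumes "\<And>b. compact (S b)"
  shows "compact (PiE UNIV S)"
  using assms compactin_PiE[of "\<lambda>_. euclidean" UNIV S] by (simp add: euclidean_product_topology)


section \<open>The dual group\<close>

lemma AutoGroup_mult:
  "f \<in> auto G \<Longrightarrow> g \<in> auto G \<Longrightarrow> f \<otimes>\<^bsub>AutoGroup G\<^esub> g = compose (carrier G) f g"
  by (simp add: AutoGroup_def BijGroup_def auto_def)

lemma AutoGroup_one: "\<one>\<^bsub>AutoGroup G\<^esub> = (\<lambda>x\<in>carrier G. x)"
  by (simp add: AutoGroup_def BijGroup_def)

lemma AutoGroup_carrier: "carrier (AutoGroup G) = auto G"
  by (simp add: AutoGroup_def)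

lemma auto_closed: "\<beta> \<in> auto G \<Longrightarrow> b \<in> carrier G \<Longrightarrow> \<beta> b \<in> carrier G"
  by (auto simp: auto_def hom_def)

lemma auto_mult:
  "\<beta> \<in> auto G \<Longrightarrow> b \<in> carrier G \<Longrightarrow> c \<in> carrier G \<Longrightarrow> \<beta> (b \<otimes>\<^bsub>G\<^esub> c) = \<beta> b \<otimes>\<^bsub>G\<^esub> \<beta> c"
  by (auto simp: auto_def hom_def)

lemma auto_bij: "\<beta> \<in> auto G \<Longrightarrow> bij_betw \<beta> (carrier G) (carrier G)"
  by (auto simp: auto_def Bij_def)

locale discrete_dual = comm_group B for B :: "('b, 'm) monoid_scheme" (structure)
begin

abbreviation K :: "('b \<Rightarrow> complex) set" where "K \<equiv> carrier (dual_group B)"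

lemma mem_K:
  "\<phi> \<in> K \<longleftrightarrow> \<phi> \<in> extensional (carrier B) \<and> (\<forall>b\<in>carrier B. cmod (\<phi> b) = 1) \<and>
     (\<forall>b\<in>carrier B. \<forall>c\<in>carrier B. \<phi> (b \<otimes> c) = \<phi> b * \<phi> c)"
  by (auto simp: dual_group_def hom_def circle_group_def)

lemma character_norm: "\<phi> \<in> K \<Longrightarrow> b \<in> carrier B \<Longrightarrow> cmod (\<phi> b) = 1"
  by (simp add: mem_K)

lemma character_mult:
  "\<phi> \<in> K \<Longrightarrow> b \<in> carrier B \<Longrightarrow> c \<in> carrier B \<Longrightarrow> \<phi> (b \<otimes> c) = \<phi> b * \<phi> c"
  by (simp add: mem_K)

lemma character_one: "\<phi> \<in> K \<Longrightarrow> \<phi> \<one> = 1"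
  using character_mult[of \<phi> \<one> \<one>] character_norm[of \<phi> \<one>] by auto

lemma character_inv:
  assumes "\<phi> \<in> K" "b \<in> carrier B"
  shows "\<phi> (inv b) = cnj (\<phi> b)"
proof -
  have "\<phi> (inv b) * \<phi> b = 1"
    using assms character_mult[of \<phi> "inv b" b] by (simp add: character_one)
  moreover have "cnj (\<phi> b) * \<phi> b = 1"
    using character_norm[OF assms] complex_norm_square[of "\<phi> b"] by (simp add: mult.commute)
  ultimately show ?thesis
    using character_norm[OF assms] by (metis mult_cancel_right mult_zero_right zero_neq_one)
qed

lemma character_eqI:
  "\<phi> \<in> K \<Longrightarrow> \<psi> \<in> K \<Longrightarrow> (\<And>b. b \<in> carrier B \<Longrightarrow> \<phi> b = \<psi> b) \<Longrightarrow> \<phi> = \<psi>"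
  by (rule extensionalityI[of _ "carrier B"]) (auto simp: mem_K)

lemma dual_mult: "\<phi> \<otimes>\<^bsub>dual_group B\<^esub> \<psi> = (\<lambda>b\<in>carrier B. \<phi> b * \<psi> b)"
  by (simp add: dual_group_def)

lemma dual_comm_group: "comm_group (dual_group B)"
proof (rule comm_groupI)
  show "\<phi> \<otimes>\<^bsub>dual_group B\<^esub> \<psi> \<in> K" if "\<phi> \<in> K" "\<psi> \<in> K" for \<phi> \<psi>
    using that by (auto simp: dual_mult mem_K norm_mult)
  show one: "\<one>\<^bsub>dual_group B\<^esub> \<in> K"
    by (auto simp: mem_K, auto simp: dual_group_def)
  show "\<exists>\<psi>\<in>K. \<psi> \<otimes>\<^bsub>dual_group B\<^esub> \<phi> = \<one>\<^bsub>dual_group B\<^esub>" if "\<phi> \<in> K" for \<phi>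
  proof
    show "(\<lambda>b\<in>carrier B. cnj (\<phi> b)) \<in> K" using that by (auto simp: mem_K)
    show "(\<lambda>b\<in>carrier B. cnj (\<phi> b)) \<otimes>\<^bsub>dual_group B\<^esub> \<phi> = \<one>\<^bsub>dual_group B\<^esub>"
    proof -
      have "cnj (\<phi> b) * \<phi> b = 1" if "b \<in> carrier B" for b
        using character_norm[OF \<open>\<phi> \<in> K\<close> that] complex_norm_square[of "\<phi> b"]
        by (simp add: mult.commute)
      then show ?thesis by (auto simp: dual_group_def fun_eq_iff)
    qed
  qed
  show "\<one>\<^bsub>dual_group B\<^esub> \<otimes>\<^bsub>dual_group B\<^esub> \<phi> = \<phi>" if "\<phi> \<in> K" for \<phi>
    using that by (auto simp: dual_group_def extensional_def fun_eq_iff)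
qed (auto simp: dual_mult fun_eq_iff)

sublocale dual: comm_group "dual_group B"
  by (rule dual_comm_group)

lemma dual_aut_apply:
  "\<phi> \<in> K \<Longrightarrow> b \<in> carrier B \<Longrightarrow> dual_aut B \<beta> \<phi> b = \<phi> (\<beta> b)"
  by (simp add: dual_aut_def)

lemma dual_aut_extensional: "dual_aut B \<beta> \<in> extensional K"
  by (simp add: dual_aut_def)

lemma dual_aut_closed: "\<beta> \<in> auto B \<Longrightarrow> \<phi> \<in> K \<Longrightarrow> dual_aut B \<beta> \<phi> \<in> K"
  by (auto simp: dual_aut_def mem_K auto_closed auto_mult)

lemma auto_compose: "\<beta> \<in> auto B \<Longrightarrow> \<gamma> \<in> auto B \<Longrightarrow> compose (carrier B) \<beta> \<gamma> \<in> auto B"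
  using group.is_monoid[OF AutoGroup] AutoGroup_mult[of \<beta> B \<gamma>] monoid.m_closed
  by (metis AutoGroup_carrier)

lemma dual_aut_compose:
  assumes "\<beta> \<in> auto B" "\<gamma> \<in> auto B" "\<phi> \<in> K"
  shows "dual_aut B (compose (carrier B) \<beta> \<gamma>) \<phi> = dual_aut B \<gamma> (dual_aut B \<beta> \<phi>)"
  using assms
  by (intro character_eqI dual_aut_closed auto_compose)
     (auto simp: dual_aut_apply dual_aut_closed auto_closed compose_def)

lemma dual_aut_id: "\<phi> \<in> K \<Longrightarrow> dual_aut B (\<lambda>b\<in>carrier B. b) \<phi> = \<phi>"
  by (intro character_eqI dual_aut_closed id_in_auto) (auto simp: dual_aut_apply)

lemma auto_inv:
  assumes "\<beta> \<in> auto B"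
  obtains \<gamma> where "\<gamma> \<in> auto B" "compose (carrier B) \<beta> \<gamma> = (\<lambda>b\<in>carrier B. b)"
    "compose (carrier B) \<gamma> \<beta> = (\<lambda>b\<in>carrier B. b)"
proof -
  interpret A: group "AutoGroup B" by (rule AutoGroup)
  have c: "\<beta> \<in> carrier (AutoGroup B)" using assms by (simp add: AutoGroup_carrier)
  show thesis
    by (rule that[of "inv\<^bsub>AutoGroup B\<^esub> \<beta>"])
       (use A.inv_closed[OF c] A.l_inv[OF c] A.r_inv[OF c] assms in
         \<open>auto simp: AutoGroup_carrier AutoGroup_one AutoGroup_mult[symmetric]\<close>)
qed

lemma dual_aut_auto:
  assumes "\<beta> \<in> auto B"
  shows "dual_aut B \<beta> \<in> auto (dual_group B)"
proof -
  obtain \<gamma> where \<gamma>: "\<gamma> \<in> auto B" "compose (carrier B) \<beta> \<gamma> = (\<lambda>b\<in>carrier B. b)"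
    "compose (carrier B) \<gamma> \<beta> = (\<lambda>b\<in>carrier B. b)" using auto_inv[OF assms] by metis
  have inv1: "dual_aut B \<gamma> (dual_aut B \<beta> \<phi>) = \<phi>" if "\<phi> \<in> K" for \<phi>
    using dual_aut_compose[OF assms \<gamma>(1) that] \<gamma> dual_aut_id[OF that] by simp
  have inv2: "dual_aut B \<beta> (dual_aut B \<gamma> \<phi>) = \<phi>" if "\<phi> \<in> K" for \<phi>
    using dual_aut_compose[OF \<gamma>(1) assms that] \<gamma> dual_aut_id[OF that] by simp
  have "bij_betw (dual_aut B \<beta>) K K"
    by (rule bij_betw_byWitness[of _ "dual_aut B \<gamma>"])
       (use inv1 inv2 dual_aut_closed assms \<gamma>(1) in auto)
  moreover note dual_aut_extensional
  moreover have "dual_aut B \<beta> \<in> hom (dual_group B) (dual_group B)"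
  proof (rule homI)
    fix \<phi> \<psi> assume *: "\<phi> \<in> K" "\<psi> \<in> K"
    show "dual_aut B \<beta> (\<phi> \<otimes>\<^bsub>dual_group B\<^esub> \<psi>) = dual_aut B \<beta> \<phi> \<otimes>\<^bsub>dual_group B\<^esub> dual_aut B \<beta> \<psi>"
      by (rule character_eqI)
         (use * assms in \<open>auto simp: dual_aut_closed dual_aut_apply dual_mult auto_closed
            dual.m_closed[unfolded dual_mult]\<close>)
  qed (use dual_aut_closed[OF assms] in auto)
  ultimately show ?thesis by (simp add: auto_def Bij_def)
qed

text \<open>
  Dualizing reverses the order of composition, which is harmless for the powers of one automorphism.
\<close>

lemma dual_aut_mult:
  assumes "\<beta> \<in> auto B" "\<gamma> \<in> auto B"
  shows "dual_aut B (\<beta> \<otimes>\<^bsub>AutoGroup B\<^esub> \<gamma>) =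
    dual_aut B \<gamma> \<otimes>\<^bsub>AutoGroup (dual_group B)\<^esub> dual_aut B \<beta>"
  unfolding AutoGroup_mult[OF assms]
    AutoGroup_mult[OF dual_aut_auto[OF assms(2)] dual_aut_auto[OF assms(1)]]
  by (rule extensionalityI[of _ K])
     (simp_all add: dual_aut_extensional dual_aut_compose[OF assms] compose_eq)

lemma dual_aut_pow:
  assumes \<alpha>: "\<alpha> \<in> auto B"
  shows "dual_aut B \<alpha> [^]\<^bsub>AutoGroup (dual_group B)\<^esub> (j::int) = dual_aut B (\<alpha> [^]\<^bsub>AutoGroup B\<^esub> j)"
proof -
  interpret A: group "AutoGroup B" by (rule AutoGroup)
  interpret D: group "AutoGroup (dual_group B)" by (rule dual.AutoGroup)
  note A = \<alpha>[folded AutoGroup_carrier] and D = dual_aut_auto[folded AutoGroup_carrier]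
  have one: "dual_aut B \<one>\<^bsub>AutoGroup B\<^esub> = \<one>\<^bsub>AutoGroup (dual_group B)\<^esub>"
    unfolding AutoGroup_one by (rule extensionalityI[of _ K]) (simp_all add: dual_aut_id dual_aut_extensional)
  have nat: "dual_aut B (\<alpha> [^]\<^bsub>AutoGroup B\<^esub> n) = dual_aut B \<alpha> [^]\<^bsub>AutoGroup (dual_group B)\<^esub> n" for n :: nat
  proof (induction n)
    case (Suc n)
    have "dual_aut B (\<alpha> [^]\<^bsub>AutoGroup B\<^esub> n \<otimes>\<^bsub>AutoGroup B\<^esub> \<alpha>) =
      dual_aut B \<alpha> \<otimes>\<^bsub>AutoGroup (dual_group B)\<^esub> dual_aut B (\<alpha> [^]\<^bsub>AutoGroup B\<^esub> n)"
      using A by (intro dual_aut_mult) (auto simp flip: AutoGroup_carrier)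
    then show ?case
      unfolding Suc A.nat_pow_Suc D.nat_pow_Suc2[OF D[OF A]] by simp
  qed (simp add: one)
  have inv: "dual_aut B (inv\<^bsub>AutoGroup B\<^esub> \<beta>) = inv\<^bsub>AutoGroup (dual_group B)\<^esub> (dual_aut B \<beta>)"
    if "\<beta> \<in> carrier (AutoGroup B)" for \<beta>
  proof -
    have b: "\<beta> \<in> auto B" "inv\<^bsub>AutoGroup B\<^esub> \<beta> \<in> auto B"
      using that A.inv_closed by (auto simp flip: AutoGroup_carrier)
    show ?thesis
      using dual_aut_mult[OF b] that one D[OF that] D[OF A.inv_closed[OF that]]
      by (intro D.inv_equality[symmetric]) auto
  qed
  show ?thesis
    unfolding int_pow_def2 using inv[OF A.nat_pow_closed[OF A]] nat by (simp del: pow_nat)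
qed

lemma continuous_on_evaluation: "continuous_on S (\<lambda>\<phi>::'b \<Rightarrow> complex. \<phi> b)"
  by (rule continuous_on_subset[OF continuous_on_product_coordinates]) auto

lemma continuous_on_dual_aut: "continuous_on K (dual_aut B \<beta>)"
proof (rule continuous_on_coordinatewise_then_product)
  fix b
  have "continuous_on K (\<lambda>\<phi>. if b \<in> carrier B then \<phi> (\<beta> b) else undefined)"
    by (cases "b \<in> carrier B") (auto intro: continuous_on_evaluation)
  then show "continuous_on K (\<lambda>\<phi>. dual_aut B \<beta> \<phi> b)"
    by (rule continuous_on_cong[THEN iffD1, rotated 2]) (auto simp: dual_aut_def)
qed

lemma compact_K: "compact K"
proof -
  let ?P = "PiE UNIV (\<lambda>b. if b \<in> carrier B then sphere (0::complex) 1 else {undefined})"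
  let ?M = "\<Inter>b\<in>carrier B. \<Inter>c\<in>carrier B. {\<phi>::'b \<Rightarrow> complex. \<phi> (b \<otimes> c) = \<phi> b * \<phi> c}"
  have "compact ?P" by (rule compact_PiE_UNIV) auto
  moreover have "closed ?M"
    by (intro closed_INT ballI closed_Collect_eq continuous_on_mult continuous_on_evaluation)
  moreover have "K = ?P \<inter> ?M"
    by (auto simp: mem_K extensional_def PiE_def Pi_def split: if_splits)
  ultimately show ?thesis by (simp add: compact_Int_closed)
qed

end


section \<open>Trigonometric polynomials and Haar measure\<close>

context discrete_dual
begin

text \<open>
  The finite linear combinations of characters, as functions on all of \<open>'b \<Rightarrow> complex\<close>.  Products
  and constants are trigonometric polynomials only up to agreement on the dual group, since
  \<open>\<phi> b * \<phi> c = \<phi> (b \<otimes> c)\<close> needs \<open>\<phi>\<close> to be a character.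
\<close>

inductive_set trig_poly :: "(('b \<Rightarrow> complex) \<Rightarrow> complex) set" where
  character: "b \<in> carrier B \<Longrightarrow> (\<lambda>\<phi>. \<phi> b) \<in> trig_poly"
| add: "p \<in> trig_poly \<Longrightarrow> q \<in> trig_poly \<Longrightarrow> (\<lambda>\<phi>. p \<phi> + q \<phi>) \<in> trig_poly"
| scale: "p \<in> trig_poly \<Longrightarrow> (\<lambda>\<phi>. c * p \<phi>) \<in> trig_poly"

lemma trig_poly_continuous: "p \<in> trig_poly \<Longrightarrow> continuous_on K p"
  by (induction rule: trig_poly.induct)
     (auto intro: continuous_on_evaluation continuous_on_add continuous_on_mult)

lemma trig_poly_character_mult:
  assumes "p \<in> trig_poly" and b: "b \<in> carrier B"
  shows "\<exists>r\<in>trig_poly. \<forall>\<phi>\<in>K. r \<phi> = \<phi> b * p \<phi>"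
  using assms(1)
proof induction
  case (character c)
  then show ?case
    using b by (intro bexI[of _ "\<lambda>\<phi>. \<phi> (b \<otimes> c)"] trig_poly.character) (auto simp: character_mult)
next
  case (add p q)
  then obtain r s where "r \<in> trig_poly" "s \<in> trig_poly"
    "\<forall>\<phi>\<in>K. r \<phi> = \<phi> b * p \<phi>" "\<forall>\<phi>\<in>K. s \<phi> = \<phi> b * q \<phi>" by blast
  then show ?case
    by (intro bexI[of _ "\<lambda>\<phi>. r \<phi> + s \<phi>"] trig_poly.add) (auto simp: algebra_simps)
next
  case (scale p c)
  then obtain r where "r \<in> trig_poly" "\<forall>\<phi>\<in>K. r \<phi> = \<phi> b * p \<phi>" by blast
  then show ?case
    by (intro bexI[of _ "\<lambda>\<phi>. c * r \<phi>"] trig_poly.scale) (auto simp: algebra_simps)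
qed

lemma trig_poly_mult:
  assumes "q \<in> trig_poly" and p: "p \<in> trig_poly"
  shows "\<exists>r\<in>trig_poly. \<forall>\<phi>\<in>K. r \<phi> = q \<phi> * p \<phi>"
  using assms(1)
proof induction
  case (character b)
  then show ?case by (rule trig_poly_character_mult[OF p])
next
  case (add q q')
  then obtain r s where "r \<in> trig_poly" "s \<in> trig_poly"
    "\<forall>\<phi>\<in>K. r \<phi> = q \<phi> * p \<phi>" "\<forall>\<phi>\<in>K. s \<phi> = q' \<phi> * p \<phi>" by blast
  then show ?case
    by (intro bexI[of _ "\<lambda>\<phi>. r \<phi> + s \<phi>"] trig_poly.add) (auto simp: algebra_simps)
next
  case (scale q c)
  then obtain r where "r \<in> trig_poly" "\<forall>\<phi>\<in>K. r \<phi> = q \<phi> * p \<phi>" by blast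
  then show ?case
    by (intro bexI[of _ "\<lambda>\<phi>. c * r \<phi>"] trig_poly.scale) (auto simp: algebra_simps)
qed

definition real_trig_poly :: "(('b \<Rightarrow> complex) \<Rightarrow> real) set" where
  "real_trig_poly = {f. \<exists>p\<in>trig_poly. \<forall>\<phi>\<in>K. p \<phi> = of_real (f \<phi>)}"

text \<open>
  Conjugating \<open>\<phi> b\<close> gives \<open>\<phi> (inv b)\<close>, so the real and imaginary parts of characters are real
  trigonometric polynomials; they separate the points of the dual group.
\<close>

lemma Re_character: "b \<in> carrier B \<Longrightarrow> (\<lambda>\<phi>. Re (\<phi> b)) \<in> real_trig_poly"
  unfolding real_trig_poly_def
  by (rule CollectI, rule bexI[of _ "\<lambda>\<phi>. 1/2 * (\<phi> b + \<phi> (inv b))"])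
     (simp add: character_inv complex_eq_iff, intro trig_poly.intros inv_closed)

lemma Im_character: "b \<in> carrier B \<Longrightarrow> (\<lambda>\<phi>. Im (\<phi> b)) \<in> real_trig_poly"
  unfolding real_trig_poly_def
  by (rule CollectI, rule bexI[of _ "\<lambda>\<phi>. (-\<i>/2) * (\<phi> b + (-1) * \<phi> (inv b))"])
     (simp add: character_inv complex_eq_iff, intro trig_poly.intros inv_closed)

sublocale trig: function_ring_on real_trig_poly K
proof
  show "compact K" by (rule compact_K)
  show "continuous_on K f" if f: "f \<in> real_trig_poly" for f
  proof -
    obtain p where p: "p \<in> trig_poly" "\<forall>\<phi>\<in>K. p \<phi> = of_real (f \<phi>)"
      using f by (auto simp: real_trig_poly_def)
    have "continuous_on K (\<lambda>\<phi>. Re (p \<phi>))"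
      by (intro continuous_intros trig_poly_continuous p)
    then show ?thesis
      by (rule continuous_on_cong[THEN iffD1, rotated 2]) (use p in auto)
  qed
  show "(\<lambda>x. f x + g x) \<in> real_trig_poly" if fg: "f \<in> real_trig_poly" "g \<in> real_trig_poly" for f g
  proof -
    obtain p q where "p \<in> trig_poly" "\<forall>\<phi>\<in>K. p \<phi> = of_real (f \<phi>)"
      "q \<in> trig_poly" "\<forall>\<phi>\<in>K. q \<phi> = of_real (g \<phi>)"
      using fg by (auto simp: real_trig_poly_def)
    then show ?thesis
      unfolding real_trig_poly_def
      by (intro CollectI bexI[of _ "\<lambda>\<phi>. p \<phi> + q \<phi>"] trig_poly.add) auto
  qed
  show "(\<lambda>x. f x * g x) \<in> real_trig_poly" if fg: "f \<in> real_trig_poly" "g \<in> real_trig_poly" for f g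
  proof -
    obtain p q where pq: "p \<in> trig_poly" "\<forall>\<phi>\<in>K. p \<phi> = of_real (f \<phi>)"
      "q \<in> trig_poly" "\<forall>\<phi>\<in>K. q \<phi> = of_real (g \<phi>)"
      using fg by (auto simp: real_trig_poly_def)
    obtain r where "r \<in> trig_poly" "\<forall>\<phi>\<in>K. r \<phi> = p \<phi> * q \<phi>"
      using trig_poly_mult[OF pq(1,3)] by blast
    then show ?thesis
      unfolding real_trig_poly_def
      by (intro CollectI bexI[of _ r]) (use pq in auto)
  qed
  show "(\<lambda>_. c) \<in> real_trig_poly" for c
    unfolding real_trig_poly_def
    by (intro CollectI bexI[of _ "\<lambda>\<phi>. of_real c * \<phi> \<one>"] trig_poly.intros)
       (auto simp: character_one)
  show "\<exists>f\<in>real_trig_poly. f \<phi> \<noteq> f \<psi>" if sep: "\<phi> \<in> K" "\<psi> \<in> K" "\<phi> \<noteq> \<psi>" for \<phi> \<psi>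
  proof -
    obtain b where "b \<in> carrier B" "\<phi> b \<noteq> \<psi> b" using character_eqI[OF sep(1,2)] sep(3) by blast
    then show ?thesis using Re_character Im_character complex_eq_iff by metis
  qed
qed

end

locale dual_haar = discrete_dual B for B :: "('b, 'm) monoid_scheme" (structure) +
  fixes \<mu> :: "('b \<Rightarrow> complex) measure"
  assumes haar: "normalized_haar_measure (dual_group B) \<mu>"
begin

lemma sets_haar: "sets \<mu> = sets (restrict_space borel K)"
  using haar by (simp add: normalized_haar_measure_def)

lemma space_haar [simp]: "space \<mu> = K"
  using sets_eq_imp_space_eq[OF sets_haar] by (simp add: space_restrict_space)

sublocale finite_measure \<mu>
  by (rule finite_measureI) (use haar in \<open>simp add: normalized_haar_measure_def\<close>)

lemma measure_K: "measure \<mu> K = 1"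
  using haar by (simp add: normalized_haar_measure_def measure_def)

lemma sets_subset_K: "E \<in> sets \<mu> \<Longrightarrow> E \<subseteq> K"
  using sets.sets_into_space[of E \<mu>] by simp

lemma compact_in_sets: "compact C \<Longrightarrow> C \<subseteq> K \<Longrightarrow> C \<in> sets \<mu>"
  using borel_compact[of C] borel_compact[OF compact_K]
  by (simp add: sets_haar sets_restrict_space_iff)

lemma open_in_sets: "open V \<Longrightarrow> V \<inter> K \<in> sets \<mu>"
  by (auto simp: sets_haar sets_restrict_space Int_commute)

lemma continuous_on_measurable: "continuous_on K f \<Longrightarrow> f \<in> borel_measurable \<mu>"
  using borel_measurable_continuous_on_restrict[of K f] measurable_cong_sets[OF sets_haar refl]
  by blast

lemma continuous_on_measurable_K:
  assumes "continuous_on K T" "T \<in> K \<rightarrow> K"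
  shows "T \<in> measurable \<mu> \<mu>"
proof -
  have "T \<in> measurable \<mu> (restrict_space borel K)"
    using assms by (intro measurable_restrict_space2 continuous_on_measurable) auto
  then show ?thesis using measurable_cong_sets[OF refl sets_haar] by blast
qed

lemma inner_approximation:
  assumes E: "E \<in> sets \<mu>" and e: "0 < (e::real)"
  obtains C where "compact C" "C \<subseteq> E" "measure \<mu> E < measure \<mu> C + e"
proof (cases "measure \<mu> E < e")
  case True
  then show thesis by (intro that[of "{}"]) auto
next
  case False
  have "ennreal (measure \<mu> E - e) < emeasure \<mu> E"
    using False e by (simp add: emeasure_eq_measure ennreal_less_iff)
  also have "emeasure \<mu> E = (SUP C\<in>{C. compact C \<and> C \<subseteq> E}. emeasure \<mu> C)"
    using haar E by (simp add: normalized_haar_measure_def)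
  finally obtain C where C: "compact C" "C \<subseteq> E" "ennreal (measure \<mu> E - e) < emeasure \<mu> C"
    unfolding less_SUP_iff by auto
  then show thesis
    using False by (intro that[of C]) (auto simp: emeasure_eq_measure ennreal_less_iff)
qed

lemma outer_approximation:
  assumes E: "E \<in> sets \<mu>" and e: "0 < (e::real)"
  obtains V where "open V" "E \<subseteq> V" "measure \<mu> (V \<inter> K) < measure \<mu> E + e"
proof -
  have "\<forall>E\<in>sets \<mu>. emeasure \<mu> E = (INF V\<in>{V. open V \<and> E \<subseteq> V}. emeasure \<mu> (V \<inter> K))"
    using haar unfolding normalized_haar_measure_def by blast
  from bspec[OF this E, symmetric]
  have "(INF V\<in>{V. open V \<and> E \<subseteq> V}. emeasure \<mu> (V \<inter> K)) = emeasure \<mu> E" .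
  also have "\<dots> < ennreal (measure \<mu> E + e)"
    using e by (simp add: emeasure_eq_measure ennreal_less_iff)
  finally obtain V where V: "open V" "E \<subseteq> V" "emeasure \<mu> (V \<inter> K) < ennreal (measure \<mu> E + e)"
    unfolding INF_less_iff by auto
  then show thesis
    by (intro that[of V]) (auto simp: emeasure_eq_measure ennreal_less_iff)
qed

text \<open>
  A step in the proof of the Stone--Weierstrass theorem lets a trigonometric polynomial play the role
  of the function in Urysohn's lemma, up to an error \<open>e\<close>.
\<close>

lemma trig_urysohn:
  assumes "compact C" "C \<subseteq> V" "C \<subseteq> K" "open V" "0 < e" "e < 1"
  obtains f where "f \<in> real_trig_poly" "\<And>\<phi>. \<phi> \<in> K \<Longrightarrow> 0 \<le> f \<phi>" "\<And>\<phi>. \<phi> \<in> K \<Longrightarrow> f \<phi> \<le> 1"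
    "\<And>\<phi>. \<phi> \<in> K \<Longrightarrow> \<phi> \<notin> V \<Longrightarrow> f \<phi> < e" "\<And>\<phi>. \<phi> \<in> C \<Longrightarrow> 1 - e < f \<phi>"
proof -
  have "closed (K - V)" "closed C"
    using assms compact_K by (auto intro: compact_imp_closed closed_Diff)
  then obtain f where "f \<in> real_trig_poly" "f ` K \<subseteq> {0..1}"
     "\<forall>x\<in>K - V. f x < e" "\<forall>x\<in>C. 1 - e < f x"
    using trig.two[of "K - V" C e] assms by blast
  then show thesis by (intro that[of f]) (auto simp: image_subset_iff)
qed

text \<open>
  Regularity encloses \<open>E\<close> between compact sets \<open>C\<^sub>n\<close> and open sets \<open>V\<^sub>n\<close> with
  \<open>\<mu> (V\<^sub>n - C\<^sub>n) \<le> 2\<^sup>-\<^sup>n\<close>.  By the Borel--Cantelli lemma almost every point lies in only finitely many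
  of the gaps, and outside the gaps the polynomials given by \<open>trig_urysohn\<close> are close to the
  indicator function of \<open>E\<close>.
\<close>

lemma indicator_trig_limit:
  assumes E: "E \<in> sets \<mu>"
  obtains p where "\<And>n. p n \<in> trig_poly" "\<And>n \<phi>. \<phi> \<in> K \<Longrightarrow> cmod (p n \<phi>) \<le> 1"
    "AE \<phi> in \<mu>. (\<lambda>n. p n \<phi>) \<longlonglongrightarrow> indicator E \<phi>"
proof -
  let ?e = "\<lambda>n::nat. (1/2) ^ Suc n :: real"
  define P where "P n C V p \<longleftrightarrow> compact C \<and> C \<subseteq> E \<and> open V \<and> E \<subseteq> V \<and> measure \<mu> E < measure \<mu> C + ?e n \<and>
     measure \<mu> (V \<inter> K) < measure \<mu> E + ?e n \<and> p \<in> trig_poly \<and> (\<forall>\<phi>\<in>K. cmod (p \<phi>) \<le> 1) \<and>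
     (\<forall>\<phi>\<in>K - V. cmod (p \<phi>) < ?e n) \<and> (\<forall>\<phi>\<in>C. cmod (p \<phi> - 1) < ?e n)" for n C V p
  have "\<exists>C V p. P n C V p" for n
  proof -
    have e: "0 < ?e n" "?e n < 1" by (simp, rule power_Suc_less_one) auto
    obtain C where C: "compact C" "C \<subseteq> E" "measure \<mu> E < measure \<mu> C + ?e n"
      using inner_approximation[OF E e(1)] .
    obtain V where V: "open V" "E \<subseteq> V" "measure \<mu> (V \<inter> K) < measure \<mu> E + ?e n"
      using outer_approximation[OF E e(1)] .
    have CV: "C \<subseteq> V" "C \<subseteq> K" using C V sets_subset_K[OF E] by auto
    obtain f where f: "f \<in> real_trig_poly" "\<And>\<phi>. \<phi> \<in> K \<Longrightarrow> 0 \<le> f \<phi>" "\<And>\<phi>. \<phi> \<in> K \<Longrightarrow> f \<phi> \<le> 1"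
      "\<And>\<phi>. \<phi> \<in> K \<Longrightarrow> \<phi> \<notin> V \<Longrightarrow> f \<phi> < ?e n" "\<And>\<phi>. \<phi> \<in> C \<Longrightarrow> 1 - ?e n < f \<phi>"
      by (rule trig_urysohn[OF C(1) CV V(1) e]) blast
    obtain p where p: "p \<in> trig_poly" "\<And>\<phi>. \<phi> \<in> K \<Longrightarrow> p \<phi> = of_real (f \<phi>)"
      using f(1) by (auto simp: real_trig_poly_def)
    have "cmod (p \<phi> - 1) < ?e n" if "\<phi> \<in> C" for \<phi>
    proof -
      have "\<phi> \<in> K" using CV that by auto
      then have "p \<phi> - 1 = of_real (f \<phi> - 1)"
        by (simp add: p(2))
      then have "cmod (p \<phi> - 1) = \<bar>f \<phi> - 1\<bar>"
        by (simp only: norm_of_real)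
      then show ?thesis using f(3)[OF \<open>\<phi> \<in> K\<close>] f(5)[OF that] by linarith
    qed
    moreover have "cmod (p \<phi>) \<le> 1" "\<phi> \<notin> V \<Longrightarrow> cmod (p \<phi>) < ?e n" if "\<phi> \<in> K" for \<phi>
      using f(2,3,4)[OF that] p(2)[OF that] by (auto simp del: power_Suc)
    ultimately have "P n C V p" using C V p(1) unfolding P_def by blast
    then show ?thesis by blast
  qed
  then obtain C V p where "\<And>n. P n (C n) (V n) (p n)" by metis
  then have CVp: "\<And>n. compact (C n)" "\<And>n. C n \<subseteq> E" "\<And>n. open (V n)" "\<And>n. E \<subseteq> V n"
    "\<And>n. measure \<mu> E < measure \<mu> (C n) + ?e n" "\<And>n. measure \<mu> (V n \<inter> K) < measure \<mu> E + ?e n"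
    "\<And>n. p n \<in> trig_poly" "\<And>n \<phi>. \<phi> \<in> K \<Longrightarrow> cmod (p n \<phi>) \<le> 1"
    "\<And>n \<phi>. \<phi> \<in> K - V n \<Longrightarrow> cmod (p n \<phi>) < ?e n" "\<And>n \<phi>. \<phi> \<in> C n \<Longrightarrow> cmod (p n \<phi> - 1) < ?e n"
    unfolding P_def by blast+
  have Cs: "C n \<in> sets \<mu>" for n
    using CVp(1)[of n] CVp(2)[of n] sets_subset_K[OF E] by (intro compact_in_sets) auto
  have Vs: "V n \<inter> K \<in> sets \<mu>" for n by (rule open_in_sets) fact
  have small: "measure \<mu> (V n \<inter> K - C n) \<le> (1/2) ^ n" for n
  proof -
    have "measure \<mu> (V n \<inter> K - C n) = measure \<mu> (V n \<inter> K) - measure \<mu> (C n)"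
      using Cs Vs CVp(2)[of n] CVp(4)[of n] sets_subset_K[OF E] by (intro finite_measure_Diff) auto
    then show ?thesis using CVp(5)[of n] CVp(6)[of n] by simp
  qed
  have "AE \<phi> in \<mu>. eventually (\<lambda>n. \<phi> \<in> space \<mu> - (V n \<inter> K - C n)) sequentially"
  proof (rule borel_cantelli_AE1)
    show "summable (\<lambda>n. measure \<mu> (V n \<inter> K - C n))"
      by (rule summable_comparison_test'[of "\<lambda>n. (1/2) ^ n"]) (auto simp: small)
  qed (use Cs Vs in \<open>auto simp: emeasure_eq_measure\<close>)
  then have "AE \<phi> in \<mu>. (\<lambda>n. p n \<phi>) \<longlonglongrightarrow> indicator E \<phi>"
  proof eventually_elim
    case (elim \<phi>)
    then have "eventually (\<lambda>n. norm (p n \<phi> - indicator E \<phi>) \<le> ?e n) sequentially"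
    proof eventually_elim
      case (elim n)
      show ?case
        using CVp(9)[of \<phi> n] CVp(10)[of \<phi> n] CVp(2)[of n] CVp(4)[of n] elim
        by (cases "\<phi> \<in> E") (auto simp del: power_Suc)
    qed
    moreover have "?e \<longlonglongrightarrow> 0"
      by (rule LIMSEQ_Suc[OF LIMSEQ_power_zero]) simp
    ultimately have "(\<lambda>n. p n \<phi> - indicator E \<phi>) \<longlonglongrightarrow> 0"
      by (rule Lim_null_comparison)
    then show ?case by (simp only: LIM_zero_iff)
  qed
  then show thesis using CVp by (intro that[of p]) auto
qed

lemma integrable_continuous:
  fixes f :: "('b \<Rightarrow> complex) \<Rightarrow> 'c::{banach, second_countable_topology}"
  assumes "continuous_on K f"
  shows "integrable \<mu> f"
proof -
  have "bounded (f ` K)"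
    by (intro compact_imp_bounded compact_continuous_image assms compact_K)
  then obtain C where "\<And>\<phi>. \<phi> \<in> K \<Longrightarrow> norm (f \<phi>) \<le> C" by (auto simp: bounded_iff)
  then show ?thesis
    by (intro integrable_const_bound[of _ C] continuous_on_measurable assms AE_I2) auto
qed

subsection \<open>Invariance under dual automorphisms\<close>

lemma translation_invariant:
  assumes \<kappa>: "\<kappa> \<in> K"
  shows "(\<lambda>\<phi>. \<kappa> \<otimes>\<^bsub>dual_group B\<^esub> \<phi>) \<in> measurable \<mu> \<mu>" (is "?t \<in> _")
    and "distr \<mu> \<mu> (\<lambda>\<phi>. \<kappa> \<otimes>\<^bsub>dual_group B\<^esub> \<phi>) = \<mu>"
proof -
  have "continuous_on K ?t"
  proof (rule continuous_on_coordinatewise_then_product)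
    fix b
    have "continuous_on K (\<lambda>\<phi>. if b \<in> carrier B then \<kappa> b * \<phi> b else undefined)"
      by (cases "b \<in> carrier B") (auto intro!: continuous_on_evaluation continuous_on_mult)
    then show "continuous_on K (\<lambda>\<phi>. ?t \<phi> b)"
      by (rule continuous_on_cong[THEN iffD1, rotated 2]) (auto simp: dual_mult)
  qed
  then show t[measurable]: "?t \<in> measurable \<mu> \<mu>"
    by (rule continuous_on_measurable_K) (use \<kappa> in auto)
  show "distr \<mu> \<mu> ?t = \<mu>"
  proof (rule measure_eqI)
    fix E assume "E \<in> sets (distr \<mu> \<mu> ?t)"
    then have E: "E \<in> sets \<mu>" by simp
    have "?t -` E \<inter> K = (inv\<^bsub>dual_group B\<^esub> \<kappa>) <#\<^bsub>dual_group B\<^esub> E"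
    proof (intro equalityI subsetI)
      fix \<phi> assume *: "\<phi> \<in> ?t -` E \<inter> K"
      then have "\<phi> = inv\<^bsub>dual_group B\<^esub> \<kappa> \<otimes>\<^bsub>dual_group B\<^esub> ?t \<phi>"
        using \<kappa> by (simp add: dual.m_assoc[symmetric])
      with * show "\<phi> \<in> (inv\<^bsub>dual_group B\<^esub> \<kappa>) <#\<^bsub>dual_group B\<^esub> E"
        unfolding l_coset_def by blast
    next
      fix \<phi> assume "\<phi> \<in> (inv\<^bsub>dual_group B\<^esub> \<kappa>) <#\<^bsub>dual_group B\<^esub> E"
      then obtain \<psi> where "\<psi> \<in> E" "\<phi> = inv\<^bsub>dual_group B\<^esub> \<kappa> \<otimes>\<^bsub>dual_group B\<^esub> \<psi>"
        by (auto simp: l_coset_def)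
      moreover have "\<psi> \<in> K" using \<open>\<psi> \<in> E\<close> sets_subset_K[OF E] by auto
      ultimately show "\<phi> \<in> ?t -` E \<inter> K"
        using \<kappa> by (simp add: dual.m_assoc[symmetric])
    qed
    moreover have "emeasure \<mu> ((inv\<^bsub>dual_group B\<^esub> \<kappa>) <#\<^bsub>dual_group B\<^esub> E) = emeasure \<mu> E"
      using haar E dual.inv_closed[OF \<kappa>] unfolding normalized_haar_measure_def by blast
    ultimately show "emeasure (distr \<mu> \<mu> ?t) E = emeasure \<mu> E"
      by (simp add: emeasure_distr E)
  qed simp
qed

text \<open>
  Translating by \<open>\<kappa>\<close> multiplies the integral of \<open>\<phi> b\<close> by \<open>\<kappa> b\<close>.
\<close>

lemma integral_character_eq_0:
  assumes b: "b \<in> carrier B" and \<kappa>: "\<kappa> \<in> K" "\<kappa> b \<noteq> 1"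
  shows "(\<integral>\<phi>. \<phi> b \<partial>\<mu>) = 0"
proof -
  have "(\<integral>\<phi>. \<phi> b \<partial>\<mu>) = (\<integral>\<phi>. \<phi> b \<partial>distr \<mu> \<mu> (\<lambda>\<phi>. \<kappa> \<otimes>\<^bsub>dual_group B\<^esub> \<phi>))"
    by (simp add: translation_invariant[OF \<kappa>(1)])
  also have "\<dots> = (\<integral>\<phi>. \<kappa> b * \<phi> b \<partial>\<mu>)"
    by (subst integral_distr[OF translation_invariant(1)[OF \<kappa>(1)]
          continuous_on_measurable[OF continuous_on_evaluation]])
       (simp add: dual_mult b)
  also have "\<dots> = \<kappa> b * (\<integral>\<phi>. \<phi> b \<partial>\<mu>)" by simp
  finally show ?thesis using \<kappa>(2) by simp
qed

lemma integral_character_eq_1: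
  assumes "\<And>\<phi>. \<phi> \<in> K \<Longrightarrow> \<phi> b = 1"
  shows "(\<integral>\<phi>. \<phi> b \<partial>\<mu>) = 1"
proof -
  have "(\<integral>\<phi>. \<phi> b \<partial>\<mu>) = (\<integral>\<phi>. 1 \<partial>\<mu>)"
    by (rule Bochner_Integration.integral_cong) (auto simp: assms)
  then show ?thesis by (simp add: measure_K)
qed

lemma dual_aut_measurable: "\<beta> \<in> auto B \<Longrightarrow> dual_aut B \<beta> \<in> measurable \<mu> \<mu>"
  by (rule continuous_on_measurable_K[OF continuous_on_dual_aut]) (auto simp: dual_aut_closed)

lemma dual_aut_surj: "\<beta> \<in> auto B \<Longrightarrow> dual_aut B \<beta> ` K = K"
  using dual_aut_auto[of \<beta>] auto_bij by (auto simp: bij_betw_def)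

text \<open>
  The integral of \<open>\<phi> b\<close> is 0 or 1 according to whether some character is nontrivial at \<open>b\<close>, and
  an automorphism \<open>\<beta>\<close> preserves this alternative because its dual is surjective.
\<close>

lemma integral_trig_poly_dual_aut:
  assumes "p \<in> trig_poly" and \<beta>: "\<beta> \<in> auto B"
  shows "(\<integral>\<phi>. p (dual_aut B \<beta> \<phi>) \<partial>\<mu>) = (\<integral>\<phi>. p \<phi> \<partial>\<mu>)"
  using assms(1)
proof induction
  case (character b)
  note \<beta>b = auto_closed[OF \<beta> character]
  have eq: "(\<integral>\<phi>. dual_aut B \<beta> \<phi> b \<partial>\<mu>) = (\<integral>\<phi>. \<phi> (\<beta> b) \<partial>\<mu>)"
    by (rule Bochner_Integration.integral_cong) (auto simp: dual_aut_apply character)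
  show ?case
  proof (cases "\<exists>\<kappa>\<in>K. \<kappa> b \<noteq> 1")
    case True
    then obtain \<kappa> where \<kappa>: "\<kappa> \<in> K" "\<kappa> b \<noteq> 1" by blast
    then obtain \<psi> where \<psi>: "\<psi> \<in> K" "\<kappa> = dual_aut B \<beta> \<psi>"
      using dual_aut_surj[OF \<beta>] by blast
    then have \<psi>b: "\<psi> (\<beta> b) \<noteq> 1" using \<kappa>(2) dual_aut_apply[OF \<psi>(1) character] by simp
    then show ?thesis
      by (simp only: eq integral_character_eq_0[OF \<beta>b \<psi>(1) \<psi>b] integral_character_eq_0[OF character \<kappa>])
  next
    case False
    then have "\<phi> (\<beta> b) = 1" if "\<phi> \<in> K" for \<phi>
      using dual_aut_closed[OF \<beta> that] dual_aut_apply[OF that character] by metis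
    moreover have "\<phi> b = 1" if "\<phi> \<in> K" for \<phi> using False that by blast
    ultimately show ?thesis by (simp only: eq integral_character_eq_1)
  qed
next
  case (add p q)
  have "integrable \<mu> r" "integrable \<mu> (\<lambda>\<phi>. r (dual_aut B \<beta> \<phi>))" if "r \<in> trig_poly" for r
  proof -
    have r: "continuous_on K r" using that by (rule trig_poly_continuous)
    then show "integrable \<mu> r" by (rule integrable_continuous)
    show "integrable \<mu> (\<lambda>\<phi>. r (dual_aut B \<beta> \<phi>))"
      by (intro integrable_continuous continuous_on_compose2[OF r continuous_on_dual_aut])
         (auto simp: dual_aut_closed \<beta>)
  qed
  with add show ?case by simp
qed simp

text \<open>
  Haar measure is determined by its values on trigonometric polynomials: they control the measure of
  compact sets, by \<open>trig_urysohn\<close>, and regularity does the rest.  An inequality for all Borel sets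
  is enough, since it can be applied to complements.
\<close>

lemma distr_dual_aut:
  assumes \<beta>: "\<beta> \<in> auto B"
  shows "distr \<mu> \<mu> (dual_aut B \<beta>) = \<mu>"
proof -
  let ?T = "dual_aut B \<beta>"
  have [measurable]: "?T \<in> measurable \<mu> \<mu>" by (rule dual_aut_measurable[OF \<beta>])
  have T: "?T -` E \<inter> K \<in> sets \<mu>" if "E \<in> sets \<mu>" for E
    using measurable_sets[OF dual_aut_measurable[OF \<beta>] that] by simp
  have compact_le: "measure \<mu> (?T -` C \<inter> K) \<le> measure \<mu> C" if C: "compact C" "C \<subseteq> K" for C
  proof (rule field_le_epsilon)
    fix e :: real assume "e > 0"
    \<comment> \<open>The estimate below loses \<open>d\<close> three times: on \<open>C\<close>, off \<open>V\<close> and in the measure of \<open>V\<close>.\<close>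
    define d where "d = min (1/2) (e/3)"
    have d: "0 < d" "d < 1" "3 * d \<le> e" using \<open>e > 0\<close> by (auto simp: d_def)
    have Cs: "C \<in> sets \<mu>" by (rule compact_in_sets[OF C])
    obtain V where V: "open V" "C \<subseteq> V" "measure \<mu> (V \<inter> K) < measure \<mu> C + d"
      using outer_approximation[OF Cs d(1)] .
    have Vs: "V \<inter> K \<in> sets \<mu>" by (rule open_in_sets) fact
    obtain f where f: "f \<in> real_trig_poly" "\<And>\<phi>. \<phi> \<in> K \<Longrightarrow> 0 \<le> f \<phi>" "\<And>\<phi>. \<phi> \<in> K \<Longrightarrow> f \<phi> \<le> 1"
      "\<And>\<phi>. \<phi> \<in> K \<Longrightarrow> \<phi> \<notin> V \<Longrightarrow> f \<phi> < d" "\<And>\<phi>. \<phi> \<in> C \<Longrightarrow> 1 - d < f \<phi>"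
      by (rule trig_urysohn[OF C(1) V(2) C(2) V(1) d(1,2)]) blast
    have fc: "continuous_on K f" by (rule trig.continuous[OF f(1)])
    have fi: "integrable \<mu> f" by (rule integrable_continuous[OF fc])
    have fTi: "integrable \<mu> (\<lambda>\<phi>. f (?T \<phi>))"
      by (intro integrable_continuous continuous_on_compose2[OF fc continuous_on_dual_aut])
         (auto simp: dual_aut_closed \<beta>)
    have inv: "(\<integral>\<phi>. f (?T \<phi>) \<partial>\<mu>) = (\<integral>\<phi>. f \<phi> \<partial>\<mu>)"
    proof -
      obtain p where p: "p \<in> trig_poly" "\<And>\<phi>. \<phi> \<in> K \<Longrightarrow> p \<phi> = of_real (f \<phi>)"
        using f(1) by (auto simp: real_trig_poly_def)
      have "complex_of_real (\<integral>\<phi>. f (?T \<phi>) \<partial>\<mu>) = (\<integral>\<phi>. p (?T \<phi>) \<partial>\<mu>)"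
        unfolding integral_complex_of_real[symmetric]
        by (rule Bochner_Integration.integral_cong) (auto simp: p dual_aut_closed \<beta>)
      also have "\<dots> = (\<integral>\<phi>. p \<phi> \<partial>\<mu>)" by (rule integral_trig_poly_dual_aut[OF p(1) \<beta>])
      also have "\<dots> = complex_of_real (\<integral>\<phi>. f \<phi> \<partial>\<mu>)"
        unfolding integral_complex_of_real[symmetric]
        by (rule Bochner_Integration.integral_cong) (auto simp: p)
      finally show ?thesis by (simp only: of_real_eq_iff)
    qed
    have "measure \<mu> (?T -` C \<inter> K) * (1 - d) = (\<integral>\<phi>. (1 - d) * indicator (?T -` C \<inter> K) \<phi> \<partial>\<mu>)"
      using T[OF Cs] by simp
    also have "\<dots> \<le> (\<integral>\<phi>. f (?T \<phi>) \<partial>\<mu>)"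
    proof (rule integral_mono[OF _ fTi])
      show "integrable \<mu> (\<lambda>\<phi>. (1 - d) * indicator (?T -` C \<inter> K) \<phi>)"
        using T[OF Cs] by (simp add: emeasure_eq_measure)
      show "(1 - d) * indicator (?T -` C \<inter> K) \<phi> \<le> f (?T \<phi>)" if "\<phi> \<in> space \<mu>" for \<phi>
        using that f(2)[of "?T \<phi>"] f(5)[of "?T \<phi>"] dual_aut_closed[OF \<beta>, of \<phi>]
        by (auto simp: indicator_def)
    qed
    also have "\<dots> = (\<integral>\<phi>. f \<phi> \<partial>\<mu>)" by (rule inv)
    also have "\<dots> \<le> (\<integral>\<phi>. indicator (V \<inter> K) \<phi> + d \<partial>\<mu>)"
    proof (rule integral_mono[OF fi])
      show "integrable \<mu> (\<lambda>\<phi>. indicator (V \<inter> K) \<phi> + d)"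
        using Vs by (simp add: emeasure_eq_measure)
      show "f \<phi> \<le> indicator (V \<inter> K) \<phi> + d" if "\<phi> \<in> space \<mu>" for \<phi>
        using that f(3)[of \<phi>] f(4)[of \<phi>] d by (auto simp: indicator_def less_imp_le)
    qed
    also have "\<dots> = measure \<mu> (V \<inter> K) + d"
      using Vs by (simp add: emeasure_eq_measure measure_K)
    finally have "measure \<mu> (?T -` C \<inter> K) - d * measure \<mu> (?T -` C \<inter> K) < measure \<mu> C + 2 * d"
      using V(3) by (simp add: algebra_simps)
    moreover have "d * measure \<mu> (?T -` C \<inter> K) \<le> d * 1"
      using d bounded_measure[of "?T -` C \<inter> K"] measure_K by (intro mult_left_mono) auto
    ultimately show "measure \<mu> (?T -` C \<inter> K) \<le> measure \<mu> C + e" using d by linarith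
  qed
  have le: "measure \<mu> (?T -` E \<inter> K) \<le> measure \<mu> E" if E: "E \<in> sets \<mu>" for E
  proof (rule field_le_epsilon)
    fix e :: real assume "e > 0"
    then obtain C where C: "compact C" "C \<subseteq> ?T -` E \<inter> K" "measure \<mu> (?T -` E \<inter> K) < measure \<mu> C + e"
      using inner_approximation[OF T[OF E]] by blast
    have TC: "compact (?T ` C)"
      using C(2) by (intro compact_continuous_image C continuous_on_subset[OF continuous_on_dual_aut]) auto
    have TCE: "?T ` C \<subseteq> E" using C(2) by auto
    have TCK: "?T ` C \<subseteq> K" using TCE sets_subset_K[OF E] by auto
    have "measure \<mu> C \<le> measure \<mu> (?T -` (?T ` C) \<inter> K)"
      using C(2) by (intro finite_measure_mono T compact_in_sets TC TCK) auto
    also have "\<dots> \<le> measure \<mu> (?T ` C)" by (rule compact_le[OF TC TCK])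
    also have "\<dots> \<le> measure \<mu> E" by (rule finite_measure_mono[OF TCE E])
    finally show "measure \<mu> (?T -` E \<inter> K) \<le> measure \<mu> E + e" using C(3) by linarith
  qed
  have eq: "measure \<mu> (?T -` E \<inter> K) = measure \<mu> E" if E: "E \<in> sets \<mu>" for E
  proof -
    have KE: "K - E \<in> sets \<mu>" using sets.compl_sets[OF E] by simp
    have "?T -` (K - E) \<inter> K = K - (?T -` E \<inter> K)" using dual_aut_closed[OF \<beta>] by auto
    then have "measure \<mu> (K - (?T -` E \<inter> K)) \<le> measure \<mu> (K - E)" using le[OF KE] by simp
    then show ?thesis
      using le[OF E] finite_measure_compl[OF E] finite_measure_compl[OF T[OF E]] by simp
  qed
  show ?thesis
    by (rule measure_eqI) (simp_all add: emeasure_distr emeasure_eq_measure eq)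
qed

lemma AE_dual_aut:
  assumes "\<beta> \<in> auto B" "AE \<phi> in \<mu>. P \<phi>"
  shows "AE \<phi> in \<mu>. P (dual_aut B \<beta> \<phi>)"
  using assms(2) AE_distrD[OF dual_aut_measurable[OF assms(1)]]
  by (subst (asm) distr_dual_aut[OF assms(1), symmetric])

lemma integral_dual_aut:
  fixes f :: "('b \<Rightarrow> complex) \<Rightarrow> 'c::{banach, second_countable_topology}"
  assumes "\<beta> \<in> auto B" "f \<in> borel_measurable \<mu>"
  shows "(\<integral>\<phi>. f (dual_aut B \<beta> \<phi>) \<partial>\<mu>) = (\<integral>\<phi>. f \<phi> \<partial>\<mu>)"
  using integral_distr[OF dual_aut_measurable[OF assms(1)] assms(2)]
  by (simp add: distr_dual_aut[OF assms(1)])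

lemma integrable_dual_aut:
  fixes f :: "('b \<Rightarrow> complex) \<Rightarrow> 'c::{banach, second_countable_topology}"
  assumes "\<beta> \<in> auto B" "integrable \<mu> f"
  shows "integrable \<mu> (\<lambda>\<phi>. f (dual_aut B \<beta> \<phi>))"
  by (rule integrable_distr[OF dual_aut_measurable[OF assms(1)]])
     (simp add: distr_dual_aut assms)

end


section \<open>The unitary representation\<close>

locale dual_system = dual_haar B \<mu> for B :: "('b, 'm) monoid_scheme" (structure)
    and \<mu> :: "('b \<Rightarrow> complex) measure" +
  fixes \<alpha> :: "'b \<Rightarrow> 'b"
  assumes \<alpha>_auto: "\<alpha> \<in> auto B"
begin

abbreviation \<alpha>_pow :: "int \<Rightarrow> 'b \<Rightarrow> 'b" where
  "\<alpha>_pow j \<equiv> \<alpha> [^]\<^bsub>AutoGroup B\<^esub> j"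

abbreviation T :: "int \<Rightarrow> ('b \<Rightarrow> complex) \<Rightarrow> ('b \<Rightarrow> complex)" where
  "T j \<equiv> dual_aut B (\<alpha>_pow j)"

abbreviation G :: "(int \<times> 'b) monoid" where "G \<equiv> semidirect_int B \<alpha>"

abbreviation U :: "int \<times> 'b \<Rightarrow> (('b \<Rightarrow> complex) \<Rightarrow> complex) \<Rightarrow> ('b \<Rightarrow> complex) \<Rightarrow> complex" where
  "U \<equiv> U_fun B \<alpha>"

lemma \<alpha>_pow_auto: "\<alpha>_pow j \<in> auto B"
proof -
  interpret A: group "AutoGroup B" by (rule AutoGroup)
  show ?thesis
    using A.int_pow_closed[of \<alpha> j] \<alpha>_auto by (simp add: AutoGroup_carrier)
qed

lemma \<alpha>_pow_add: "\<alpha>_pow (j + k) = compose (carrier B) (\<alpha>_pow j) (\<alpha>_pow k)"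
proof -
  interpret A: group "AutoGroup B" by (rule AutoGroup)
  show ?thesis
    using A.int_pow_mult[of \<alpha> j k] \<alpha>_auto
    by (simp add: AutoGroup_carrier AutoGroup_mult[OF \<alpha>_pow_auto \<alpha>_pow_auto])
qed

lemma \<alpha>_pow_0: "\<alpha>_pow 0 = (\<lambda>b\<in>carrier B. b)"
  by (simp add: AutoGroup_one)

lemma \<alpha>_pow_1: "\<alpha>_pow 1 = \<alpha>"
proof -
  interpret A: group "AutoGroup B" by (rule AutoGroup)
  show ?thesis using A.int_pow_1[of \<alpha>] \<alpha>_auto by (simp add: AutoGroup_carrier)
qed

lemma T_add: "\<phi> \<in> K \<Longrightarrow> T (j + k) \<phi> = T k (T j \<phi>)"
  by (simp add: \<alpha>_pow_add dual_aut_compose \<alpha>_pow_auto)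

lemma T_0: "\<phi> \<in> K \<Longrightarrow> T 0 \<phi> = \<phi>"
  by (simp only: \<alpha>_pow_0 dual_aut_id)

lemma T_1: "T 1 = dual_aut B \<alpha>"
  by (simp only: \<alpha>_pow_1)

lemma U_apply: "U (j, b) f \<phi> = \<phi> b * f (T j \<phi>)"
  by (simp add: U_fun_def dual_aut_pow[OF \<alpha>_auto])

lemma G_carrier: "(j, b) \<in> carrier G \<longleftrightarrow> b \<in> carrier B"
  by (simp add: semidirect_int_def)

lemma G_mult: "(j, b) \<otimes>\<^bsub>G\<^esub> (k, c) = (j + k, \<alpha>_pow j c \<otimes> b)"
  by (simp add: semidirect_int_def)

lemma G_mult_closed: "g \<in> carrier G \<Longrightarrow> h \<in> carrier G \<Longrightarrow> g \<otimes>\<^bsub>G\<^esub> h \<in> carrier G"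
  by (cases g; cases h) (simp add: G_carrier G_mult auto_closed[OF \<alpha>_pow_auto])

lemma G_one: "(0, \<one>) \<in> carrier G"
  by (simp add: G_carrier)

lemma G_inverse:
  assumes "g \<in> carrier G"
  obtains h where "h \<in> carrier G" "g \<otimes>\<^bsub>G\<^esub> h = (0, \<one>)" "h \<otimes>\<^bsub>G\<^esub> g = (0, \<one>)"
proof -
  obtain j b where g: "g = (j, b)" by (cases g)
  have b: "b \<in> carrier B" using assms g by (simp add: G_carrier)
  have "\<alpha>_pow j (\<alpha>_pow (- j) c) = c" if "c \<in> carrier B" for c
    using fun_cong[OF \<alpha>_pow_add[of j "- j"], of c] that by (simp add: compose_def AutoGroup_one)
  moreover have "\<alpha>_pow (- j) b \<otimes> \<alpha>_pow (- j) (inv b) = \<alpha>_pow (- j) \<one>"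
    using b auto_mult[OF \<alpha>_pow_auto[of "- j"], of b "inv b"] by simp
  moreover have "\<alpha>_pow (- j) \<one> = \<one>"
  proof -
    have "group_hom B B (\<alpha>_pow (- j))"
      using \<alpha>_pow_auto[of "- j"] is_group by (auto simp: group_hom_def group_hom_axioms_def auto_def)
    then show ?thesis by (rule group_hom.hom_one)
  qed
  ultimately show thesis
    using b by (intro that[of "(- j, \<alpha>_pow (- j) (inv b))"])
      (simp_all add: g G_carrier G_mult auto_closed[OF \<alpha>_pow_auto] m_comm[of "\<alpha>_pow (- j) (inv b)"])
qed

lemma U_square_integrable:
  assumes g: "g \<in> carrier G" and f: "f \<in> square_integrable \<mu>"
  shows "U g f \<in> square_integrable \<mu>"
proof -
  obtain j b where g': "g = (j, b)" by (cases g)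
  have b: "b \<in> carrier B" using g g' by (simp add: G_carrier)
  have [measurable]: "f \<in> borel_measurable \<mu>" "T j \<in> measurable \<mu> \<mu>"
    "(\<lambda>\<phi>. \<phi> b) \<in> borel_measurable \<mu>"
    using f dual_aut_measurable[OF \<alpha>_pow_auto] continuous_on_measurable[OF continuous_on_evaluation]
    by (auto simp: square_integrable_def)
  have "(\<lambda>\<phi>. \<phi> b * f (T j \<phi>)) \<in> square_integrable \<mu>"
  proof (rule square_integrableI)
    have "integrable \<mu> (\<lambda>\<phi>. (cmod (f (T j \<phi>)))\<^sup>2)"
      by (rule integrable_dual_aut[OF \<alpha>_pow_auto, of "\<lambda>\<phi>. (cmod (f \<phi>))\<^sup>2"])
         (use f in \<open>simp add: square_integrable_def\<close>)
    then show "integrable \<mu> (\<lambda>\<phi>. (cmod (\<phi> b * f (T j \<phi>)))\<^sup>2)"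
      by (rule Bochner_Integration.integrable_cong[THEN iffD1, rotated 2])
         (simp_all add: norm_mult character_norm b)
  qed measurable
  then show ?thesis by (simp add: g' U_apply[abs_def])
qed

lemma U_cong_AE:
  assumes g: "g \<in> carrier G" and eq: "AE \<phi> in \<mu>. f \<phi> = f' \<phi>"
  shows "AE \<phi> in \<mu>. U g f \<phi> = U g f' \<phi>"
proof -
  obtain j b where g': "g = (j, b)" by (cases g)
  from AE_dual_aut[OF \<alpha>_pow_auto[of j] eq] show ?thesis
    unfolding g' U_apply by eventually_elim simp
qed

lemma U_L2_rel:
  assumes "g \<in> carrier G" "(f, f') \<in> L2_rel \<mu>"
  shows "(U g f, U g f') \<in> L2_rel \<mu>"
  using assms U_square_integrable U_cong_AE by (simp add: L2_rel_def)

lemma U_rep_class: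
  assumes g: "g \<in> carrier G" and f: "f \<in> square_integrable \<mu>"
  shows "U_rep B \<alpha> \<mu> g (L2_class \<mu> f) = L2_class \<mu> (U g f)"
proof -
  have "(\<Union>f'\<in>L2_class \<mu> f. L2_class \<mu> (U g f')) = L2_class \<mu> (U g f)"
  proof (rule L2_lift[OF f])
    fix f' assume f': "f' \<in> square_integrable \<mu>" "AE \<phi> in \<mu>. f \<phi> = f' \<phi>"
    then have "AE \<phi> in \<mu>. U g f \<phi> = U g f' \<phi>" by (intro U_cong_AE[OF g])
    then show "L2_class \<mu> (U g f') = L2_class \<mu> (U g f)"
      using L2_class_eq_iff[OF U_square_integrable[OF g f] U_square_integrable[OF g f'(1)]] by simp
  qed
  then show ?thesis by (simp add: U_rep_def L2_class_in_L2 f)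
qed

lemma U_rep_extensional: "U_rep B \<alpha> \<mu> g \<in> extensional (L2 \<mu>)"
  by (simp add: U_rep_def)

lemma U_rep_closed: "g \<in> carrier G \<Longrightarrow> F \<in> L2 \<mu> \<Longrightarrow> U_rep B \<alpha> \<mu> g F \<in> L2 \<mu>"
  by (erule L2_cases) (simp add: U_rep_class L2_class_in_L2 U_square_integrable)

lemma L2_class_cong:
  assumes "f \<in> square_integrable \<mu>" "g \<in> square_integrable \<mu>" "\<And>\<phi>. \<phi> \<in> K \<Longrightarrow> f \<phi> = g \<phi>"
  shows "L2_class \<mu> f = L2_class \<mu> g"
  using assms by (subst L2_class_eq_iff) auto

lemma U_mult:
  assumes "g \<in> carrier G" "h \<in> carrier G" "\<phi> \<in> K"
  shows "U (g \<otimes>\<^bsub>G\<^esub> h) f \<phi> = U g (U h f) \<phi>"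
proof -
  obtain j b k c where gh: "g = (j, b)" "h = (k, c)" by (cases g; cases h)
  have "b \<in> carrier B" "c \<in> carrier B" using assms gh by (auto simp: G_carrier)
  then show ?thesis
    using assms(3)
    by (simp add: gh G_mult U_apply T_add character_mult dual_aut_apply auto_closed[OF \<alpha>_pow_auto])
qed

lemma U_rep_mult:
  assumes g: "g \<in> carrier G" and h: "h \<in> carrier G" and F: "F \<in> L2 \<mu>"
  shows "U_rep B \<alpha> \<mu> (g \<otimes>\<^bsub>G\<^esub> h) F = U_rep B \<alpha> \<mu> g (U_rep B \<alpha> \<mu> h F)"
proof -
  obtain f where f: "f \<in> square_integrable \<mu>" "F = L2_class \<mu> f" using F by (rule L2_cases)
  show ?thesis
    unfolding f(2) U_rep_class[OF h f(1)] U_rep_class[OF g U_square_integrable[OF h f(1)]]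
      U_rep_class[OF G_mult_closed[OF g h] f(1)]
    by (intro L2_class_cong U_square_integrable G_mult_closed g h f U_mult)
qed

lemma U_rep_one:
  assumes F: "F \<in> L2 \<mu>"
  shows "U_rep B \<alpha> \<mu> (0, \<one>) F = F"
proof -
  obtain f where f: "f \<in> square_integrable \<mu>" "F = L2_class \<mu> f" using F by (rule L2_cases)
  show ?thesis
    unfolding f(2) U_rep_class[OF G_one f(1)]
    by (intro L2_class_cong U_square_integrable G_one f) (simp only: U_apply T_0 character_one mult_1)
qed

lemma U_rep_unitary:
  assumes g: "g \<in> carrier G"
  shows "U_rep B \<alpha> \<mu> g \<in> carrier (L2_unitary_group \<mu>)"
proof -
  obtain h where h: "h \<in> carrier G" "g \<otimes>\<^bsub>G\<^esub> h = (0, \<one>)" "h \<otimes>\<^bsub>G\<^esub> g = (0, \<one>)"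
    using G_inverse[OF g] .
  obtain j b where g': "g = (j, b)" by (cases g)
  have b: "b \<in> carrier B" using g g' by (simp add: G_carrier)
  have "bij_betw (U_rep B \<alpha> \<mu> g) (L2 \<mu>) (L2 \<mu>)"
  proof (rule bij_betw_byWitness[of _ "U_rep B \<alpha> \<mu> h"])
    show "\<forall>F\<in>L2 \<mu>. U_rep B \<alpha> \<mu> h (U_rep B \<alpha> \<mu> g F) = F"
      using U_rep_mult[OF h(1) g] h(3) U_rep_one by metis
    show "\<forall>F\<in>L2 \<mu>. U_rep B \<alpha> \<mu> g (U_rep B \<alpha> \<mu> h F) = F"
      using U_rep_mult[OF g h(1)] h(2) U_rep_one by metis
  qed (use U_rep_closed[OF g] U_rep_closed[OF h(1)] in blast)+
  moreover note U_rep_extensional[of g]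
  moreover have "U_rep B \<alpha> \<mu> g (L2_add \<mu> F H) = L2_add \<mu> (U_rep B \<alpha> \<mu> g F) (U_rep B \<alpha> \<mu> g H)"
    if FH: "F \<in> L2 \<mu>" "H \<in> L2 \<mu>" for F H
  proof -
    obtain f where f: "f \<in> square_integrable \<mu>" "F = L2_class \<mu> f" using FH(1) by (rule L2_cases)
    obtain k where k: "k \<in> square_integrable \<mu>" "H = L2_class \<mu> k" using FH(2) by (rule L2_cases)
    note fk = square_integrable_add[OF f(1) k(1)]
    show ?thesis
      unfolding f(2) k(2) L2_add_class[OF f(1) k(1)] U_rep_class[OF g fk] U_rep_class[OF g f(1)]
        U_rep_class[OF g k(1)]
        L2_add_class[OF U_square_integrable[OF g f(1)] U_square_integrable[OF g k(1)]]
      by (simp add: g' U_apply[abs_def] algebra_simps)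
  qed
  moreover have "U_rep B \<alpha> \<mu> g (L2_scale \<mu> c F) = L2_scale \<mu> c (U_rep B \<alpha> \<mu> g F)"
    if F: "F \<in> L2 \<mu>" for c F
  proof -
    obtain f where f: "f \<in> square_integrable \<mu>" "F = L2_class \<mu> f" using F by (rule L2_cases)
    show ?thesis
      unfolding f(2) L2_scale_class[OF f(1)] U_rep_class[OF g square_integrable_scale[OF f(1)]]
        U_rep_class[OF g f(1)] L2_scale_class[OF U_square_integrable[OF g f(1)]]
      by (simp add: g' U_apply[abs_def] algebra_simps)
  qed
  moreover have "L2_inner \<mu> (U_rep B \<alpha> \<mu> g F) (U_rep B \<alpha> \<mu> g H) = L2_inner \<mu> F H"
    if FH: "F \<in> L2 \<mu>" "H \<in> L2 \<mu>" for F H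
  proof -
    obtain f where f: "f \<in> square_integrable \<mu>" "F = L2_class \<mu> f" using FH(1) by (rule L2_cases)
    obtain k where k: "k \<in> square_integrable \<mu>" "H = L2_class \<mu> k" using FH(2) by (rule L2_cases)
    have "(\<integral>\<phi>. U g f \<phi> * cnj (U g k \<phi>) \<partial>\<mu>) = (\<integral>\<phi>. f (T j \<phi>) * cnj (k (T j \<phi>)) \<partial>\<mu>)"
    proof (rule Bochner_Integration.integral_cong)
      fix \<phi> assume "\<phi> \<in> space \<mu>"
      then have 1: "\<phi> b * cnj (\<phi> b) = 1"
        using character_norm[of \<phi> b] b complex_norm_square[of "\<phi> b"] by simp
      have "U g f \<phi> * cnj (U g k \<phi>) = (\<phi> b * cnj (\<phi> b)) * (f (T j \<phi>) * cnj (k (T j \<phi>)))"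
        by (simp add: g' U_apply algebra_simps)
      then show "U g f \<phi> * cnj (U g k \<phi>) = f (T j \<phi>) * cnj (k (T j \<phi>))"
        by (simp add: 1)
    qed simp
    also have "\<dots> = (\<integral>\<phi>. f \<phi> * cnj (k \<phi>) \<partial>\<mu>)"
      by (rule integral_dual_aut[OF \<alpha>_pow_auto, of "\<lambda>\<phi>. f \<phi> * cnj (k \<phi>)"])
         (intro borel_measurable_integrable integrable_mult_cnj f k)
    finally show ?thesis
      unfolding f(2) k(2) U_rep_class[OF g f(1)] U_rep_class[OF g k(1)] L2_inner_class[OF f(1) k(1)]
        L2_inner_class[OF U_square_integrable[OF g f(1)] U_square_integrable[OF g k(1)]] .
  qed
  ultimately show ?thesis by (simp add: L2_unitary_group_def Bij_def)
qed

lemma U_rep_unitary_rep: "unitary_rep_L2 G \<mu> (U_rep B \<alpha> \<mu>)"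
  unfolding unitary_rep_L2_def
proof (rule homI)
  fix g h assume gh: "g \<in> carrier G" "h \<in> carrier G"
  have Bij: "U_rep B \<alpha> \<mu> k \<in> Bij (L2 \<mu>)" if "k \<in> carrier G" for k
    using U_rep_unitary[OF that] by (simp add: L2_unitary_group_def)
  have "U_rep B \<alpha> \<mu> (g \<otimes>\<^bsub>G\<^esub> h) = compose (L2 \<mu>) (U_rep B \<alpha> \<mu> g) (U_rep B \<alpha> \<mu> h)"
    by (rule extensionalityI[of _ "L2 \<mu>"])
       (simp_all add: U_rep_extensional U_rep_mult[OF gh] compose_eq)
  then show "U_rep B \<alpha> \<mu> (g \<otimes>\<^bsub>G\<^esub> h)
      = U_rep B \<alpha> \<mu> g \<otimes>\<^bsub>L2_unitary_group \<mu>\<^esub> U_rep B \<alpha> \<mu> h"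
    using Bij[OF gh(1)] Bij[OF gh(2)] by (simp add: L2_unitary_group_def BijGroup_def)
qed (rule U_rep_unitary)

end


section \<open>Irreducibility and ergodicity\<close>

text \<open>
  The constant is the essential supremum of \<open>g\<close>, the infimum of the \<open>a\<close> with \<open>g \<le> a\<close> almost
  everywhere.
\<close>

lemma zero_one_constant:
  fixes g :: "'a \<Rightarrow> real"
  assumes nontriv: "\<not> (AE x in M. False)"
    and bound: "AE x in M. \<bar>g x\<bar> \<le> C"
    and zo: "\<And>a. (AE x in M. g x \<le> a) \<or> (AE x in M. g x > a)"
  obtains c where "AE x in M. g x = c"
proof -
  define A where "A = {a. AE x in M. g x \<le> a}"
  define c where "c = Inf A"
  have "AE x in M. g x \<le> C"
    using bound by eventually_elim linarith
  then have ne: "A \<noteq> {}" by (auto simp: A_def)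
  have "- C \<le> a" if "a \<in> A" for a
  proof (rule ccontr)
    assume "\<not> - C \<le> a"
    from that have "AE x in M. g x \<le> a" by (simp add: A_def)
    with bound have "AE x in M. False"
      by eventually_elim (use \<open>\<not> - C \<le> a\<close> in linarith)
    with nontriv show False ..
  qed
  then have bdd: "bdd_below A" by (rule bdd_belowI)
  have up: "AE x in M. g x \<le> c + inverse (real (Suc n))" for n
  proof -
    have "Inf A < c + inverse (real (Suc n))" by (simp add: c_def)
    then obtain a where a: "a \<in> A" "a < c + inverse (real (Suc n))"
      using cInf_less_iff[OF ne bdd] by blast
    from a(1) have "AE x in M. g x \<le> a" by (simp add: A_def)
    then show ?thesis by eventually_elim (use a(2) in linarith)
  qed
  have lo: "AE x in M. g x > c - inverse (real (Suc n))" for n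
  proof -
    have "c - inverse (real (Suc n)) \<notin> A"
      using cInf_lower[OF _ bdd, of "c - inverse (real (Suc n))"] unfolding c_def by auto
    then show ?thesis using zo[of "c - inverse (real (Suc n))"] by (auto simp: A_def)
  qed
  have "AE x in M. \<forall>n. g x \<le> c + inverse (real (Suc n))" "AE x in M. \<forall>n. g x > c - inverse (real (Suc n))"
    unfolding AE_all_countable using up lo by auto
  then have "AE x in M. g x = c"
  proof eventually_elim
    case (elim x)
    have "\<not> \<bar>g x - c\<bar> > 0"
    proof
      assume "\<bar>g x - c\<bar> > 0"
      then obtain n where "inverse (real (Suc n)) < \<bar>g x - c\<bar>" using reals_Archimedean by blast
      then show False using elim(1)[rule_format, of n] elim(2)[rule_format, of n] by linarith
    qed
    then show ?case by simp
  qed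
  then show thesis by (rule that)
qed

context dual_haar
begin

lemma AE_nontrivial: "\<not> (AE \<phi> in \<mu>. False)"
proof
  assume "AE \<phi> in \<mu>. False"
  then have "emeasure \<mu> K = 0"
    by (subst (asm) AE_iff_measurable[of K]) (use sets.top[of \<mu>] in auto)
  then show False using measure_K by (simp add: measure_def)
qed

end

context dual_system
begin

lemma L2_nontrivial: "L2 \<mu> \<noteq> {L2_zero \<mu>}"
proof
  assume eq: "L2 \<mu> = {L2_zero \<mu>}"
  have one: "(\<lambda>\<phi>. 1) \<in> square_integrable \<mu>" by (rule square_integrable_bounded[of _ 1]) auto
  from L2_class_in_L2[OF one] eq L2_class_eq_zero_iff[OF one] have "AE \<phi> in \<mu>. False" by simp
  then show False using AE_nontrivial by blast
qed

definition invariant_subspace :: "(('b \<Rightarrow> complex) \<Rightarrow> complex) set set \<Rightarrow> bool" where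
  "invariant_subspace W \<longleftrightarrow> L2_closed_subspace \<mu> W \<and> (\<forall>g\<in>carrier G. U_rep B \<alpha> \<mu> g ` W \<subseteq> W)"

lemma invariant_subspace_U:
  assumes "invariant_subspace W" "g \<in> carrier G" "f \<in> square_integrable \<mu>" "L2_class \<mu> f \<in> W"
  shows "L2_class \<mu> (U g f) \<in> W"
  using assms U_rep_class[OF assms(2,3)] unfolding invariant_subspace_def by force

text \<open>
  The operators \<open>U (0, b)\<close> multiply by characters, so an invariant subspace is stable under
  multiplication by trigonometric polynomials, and these converge to indicator functions.
\<close>

lemma invariant_indicator_stable:
  assumes W: "invariant_subspace W"
  shows "indicator_stable \<mu> W"
  unfolding indicator_stable_def
proof (intro conjI ballI impI)
  show cl: "L2_closed_subspace \<mu> W" using W by (simp add: invariant_subspace_def)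
  fix E f assume E: "E \<in> sets \<mu>" and f: "f \<in> square_integrable \<mu>" "L2_class \<mu> f \<in> W"
  have fm[measurable]: "f \<in> borel_measurable \<mu>" using f by (simp add: square_integrable_def)
  have step: "L2_class \<mu> (\<lambda>\<phi>. p \<phi> * f \<phi>) \<in> W \<and> (\<lambda>\<phi>. p \<phi> * f \<phi>) \<in> square_integrable \<mu>"
    if "p \<in> trig_poly" for p
    using that
  proof induction
    case (character b)
    then have g: "(0, b) \<in> carrier G" by (simp add: G_carrier)
    have [measurable]: "(\<lambda>\<phi>. \<phi> b) \<in> borel_measurable \<mu>"
      by (rule continuous_on_measurable[OF continuous_on_evaluation])
    have si: "(\<lambda>\<phi>. \<phi> b * f \<phi>) \<in> square_integrable \<mu>"
      by (rule square_integrable_dominated[OF f(1), where C = 1])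
         (measurable, auto simp: norm_mult character_norm character)
    have "L2_class \<mu> (U (0, b) f) = L2_class \<mu> (\<lambda>\<phi>. \<phi> b * f \<phi>)"
      by (intro L2_class_cong U_square_integrable g f si) (simp only: U_apply T_0)
    then show ?case using invariant_subspace_U[OF W g f] si by simp
  next
    case (add p q)
    then show ?case
      using closed_subspace_add[OF cl, of "\<lambda>\<phi>. p \<phi> * f \<phi>" "\<lambda>\<phi>. q \<phi> * f \<phi>"]
        square_integrable_add[of "\<lambda>\<phi>. p \<phi> * f \<phi>" \<mu> "\<lambda>\<phi>. q \<phi> * f \<phi>"]
      by (simp add: distrib_right)
  next
    case (scale p c)
    then show ?case
      using closed_subspace_scale[OF cl, of "\<lambda>\<phi>. p \<phi> * f \<phi>" c]
        square_integrable_scale[of "\<lambda>\<phi>. p \<phi> * f \<phi>" \<mu> c]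
      by (simp add: mult.assoc)
  qed
  obtain p where p: "\<And>n. p n \<in> trig_poly" "\<And>n \<phi>. \<phi> \<in> K \<Longrightarrow> cmod (p n \<phi>) \<le> 1"
    "AE \<phi> in \<mu>. (\<lambda>n. p n \<phi>) \<longlonglongrightarrow> indicator E \<phi>"
    by (rule indicator_trig_limit[OF E]) blast
  have pm: "p n \<in> borel_measurable \<mu>" for n
    by (rule continuous_on_measurable[OF trig_poly_continuous[OF p(1)]])
  show "L2_class \<mu> (\<lambda>\<phi>. indicator E \<phi> * f \<phi>) \<in> W"
  proof (rule closed_subspace_dominated_limit[OF cl, where s = "\<lambda>n \<phi>. p n \<phi> * f \<phi>" and g = f and C = 1])
    show "L2_class \<mu> (\<lambda>\<phi>. p n \<phi> * f \<phi>) \<in> W" for n using step[OF p(1)] by blast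
    show "AE \<phi> in \<mu>. (\<lambda>n. p n \<phi> * f \<phi>) \<longlonglongrightarrow> indicator E \<phi> * f \<phi>"
      using p(3) by eventually_elim (intro tendsto_mult tendsto_const)
    show "AE \<phi> in \<mu>. cmod (p n \<phi> * f \<phi>) \<le> 1 * cmod (f \<phi>)" for n
      by (rule AE_I2) (use p(2) in \<open>simp add: norm_mult mult_left_le_one_le\<close>)
    show "(\<lambda>\<phi>. p n \<phi> * f \<phi>) \<in> borel_measurable \<mu>" for n
      by (intro borel_measurable_times pm fm)
    show "(\<lambda>\<phi>. indicator E \<phi> * f \<phi>) \<in> borel_measurable \<mu>"
      using E by measurable
  qed (rule f)
qed

text \<open>
  Applying \<open>U (1, \<one>)\<close> to its indicator function shows that the support \<open>S\<close> of an invariant subspace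
  contains its own preimage up to a null set; since Haar measure is preserved, the two agree almost
  everywhere.
\<close>

lemma ergodic_imp_irreducible:
  assumes erg: "ergodic \<mu> (dual_aut B \<alpha>)"
  shows "irreducible_rep_L2 G \<mu> (U_rep B \<alpha> \<mu>)"
  unfolding irreducible_rep_L2_def
proof (intro conjI allI impI U_rep_unitary_rep L2_nontrivial)
  fix W assume "L2_closed_subspace \<mu> W \<and> (\<forall>g\<in>carrier G. U_rep B \<alpha> \<mu> g ` W \<subseteq> W)"
  then have W: "invariant_subspace W" by (simp add: invariant_subspace_def)
  then have cl: "L2_closed_subspace \<mu> W" by (simp add: invariant_subspace_def)
  have stable: "indicator_stable \<mu> W" by (rule invariant_indicator_stable[OF W])
  obtain S where S: "S \<in> sets \<mu>" "L2_class \<mu> (indicator S) \<in> W"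
    "\<And>f. f \<in> square_integrable \<mu> \<Longrightarrow> L2_class \<mu> f \<in> W \<Longrightarrow> AE \<phi> in \<mu>. \<phi> \<notin> S \<longrightarrow> f \<phi> = 0"
    by (rule indicator_stable_support[OF stable]) blast
  let ?T = "dual_aut B \<alpha>"
  have g: "(1, \<one>) \<in> carrier G" by (simp add: G_carrier)
  note ind = indicator_square_integrable[OF S(1)]
  have "AE \<phi> in \<mu>. \<phi> \<notin> S \<longrightarrow> U (1, \<one>) (indicator S) \<phi> = 0"
    by (rule S(3)[OF U_square_integrable[OF g ind] invariant_subspace_U[OF W g ind S(2)]])
  moreover have "AE \<phi> in \<mu>. \<phi> \<in> K" by (rule AE_I2) simp
  ultimately have sub: "AE \<phi> in \<mu>. ?T \<phi> \<in> S \<longrightarrow> \<phi> \<in> S"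
    by eventually_elim (simp only: U_apply T_1 character_one, simp add: indicator_def split: if_splits, blast)
  define D where "D = ?T -` S \<inter> K"
  have D: "D \<in> sets \<mu>"
    using measurable_sets[OF dual_aut_measurable[OF \<alpha>_auto] S(1)] by (simp add: D_def)
  have "emeasure \<mu> D = emeasure (distr \<mu> \<mu> ?T) S"
    using S(1) dual_aut_measurable[OF \<alpha>_auto] by (simp add: emeasure_distr D_def)
  then have DS: "measure \<mu> D = measure \<mu> S" by (simp add: distr_dual_aut[OF \<alpha>_auto] measure_def)
  have "measure \<mu> (D \<inter> S) = measure \<mu> D"
  proof (rule finite_measure_eq_AE)
    show "AE \<phi> in \<mu>. (\<phi> \<in> D \<inter> S) = (\<phi> \<in> D)" using sub by eventually_elim (simp add: D_def, blast)
  qed (use D S(1) in simp_all)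
  then have "measure \<mu> (S - D) = 0"
    using finite_measure_Diff'[OF S(1) D] DS by (simp add: Int_commute)
  then have "AE \<phi> in \<mu>. \<phi> \<notin> S - D"
    by (intro AE_not_in) (use S(1) D in \<open>auto simp: null_sets_def emeasure_eq_measure\<close>)
  with sub have inv: "AE \<phi> in \<mu>. (indicator S (?T \<phi>) :: complex) = indicator S \<phi>"
    by eventually_elim (use sets_subset_K[OF S(1)] in \<open>auto simp: D_def indicator_def\<close>)
  have "\<exists>c. AE \<phi> in \<mu>. (indicator S \<phi> :: complex) = c"
  proof (rule erg[unfolded ergodic_def, rule_format], intro conjI)
    show "(indicator S :: _ \<Rightarrow> complex) \<in> borel_measurable \<mu>" using S(1) by measurable
    show "\<exists>C. AE \<phi> in \<mu>. cmod (indicator S \<phi>) \<le> C"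
      by (intro exI[of _ 1] AE_I2) (simp add: indicator_def)
  qed (rule inv)
  then obtain c where c: "AE \<phi> in \<mu>. (indicator S \<phi> :: complex) = c" by blast
  show "W = {L2_zero \<mu>} \<or> W = L2 \<mu>"
  proof (cases "c = 0")
    case True
    have "F = L2_zero \<mu>" if "F \<in> W" for F
    proof -
      have "F \<in> L2 \<mu>" using that cl by (auto simp: L2_closed_subspace_def)
      then obtain f where f: "f \<in> square_integrable \<mu>" "F = L2_class \<mu> f" by (rule L2_cases)
      have "AE \<phi> in \<mu>. \<phi> \<notin> S \<longrightarrow> f \<phi> = 0" using S(3)[OF f(1)] that f(2) by simp
      with c have "AE \<phi> in \<mu>. f \<phi> = 0"
        by eventually_elim (use True in \<open>auto simp: indicator_def split: if_splits\<close>)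
      then show ?thesis using L2_class_eq_zero_iff[OF f(1)] f(2) by simp
    qed
    moreover have "L2_zero \<mu> \<in> W" using cl by (simp add: L2_closed_subspace_def)
    ultimately show ?thesis by blast
  next
    case False
    from c have "AE \<phi> in \<mu>. indicator S \<phi> = (1::complex)"
      by eventually_elim (use False in \<open>auto simp: indicator_def split: if_splits\<close>)
    then have "L2_class \<mu> (\<lambda>\<phi>. 1) \<in> W"
      by (intro closed_subspace_cong[OF S(2) ind] square_integrable_bounded[of _ 1]) auto
    then show ?thesis using indicator_stable_eq_L2[OF stable] by blast
  qed
qed

lemma AE_invariant_pow:
  assumes inv: "AE \<phi> in \<mu>. g (dual_aut B \<alpha> \<phi>) = g \<phi>"
  shows "AE \<phi> in \<mu>. g (T j \<phi>) = g \<phi>"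
proof -
  have K: "AE \<phi> in \<mu>. \<phi> \<in> K" by (rule AE_I2) simp
  have nat: "AE \<phi> in \<mu>. g (T (int n) \<phi>) = g \<phi>" for n
  proof (induction n)
    case 0
    show ?case using K by eventually_elim (simp only: of_nat_0 T_0)
  next
    case (Suc n)
    have eq: "T (int (Suc n)) \<phi> = dual_aut B \<alpha> (T (int n) \<phi>)" if "\<phi> \<in> K" for \<phi>
      using T_add[OF that, of "int n" 1] by (simp only: T_1 of_nat_Suc add.commute)
    from Suc AE_dual_aut[OF \<alpha>_pow_auto[of "int n"] inv] K show ?case
      by eventually_elim (simp only: eq)
  qed
  show ?thesis
  proof (cases "j \<ge> 0")
    case True
    then show ?thesis using nat[of "nat j"] by simp
  next
    case False
    have eq: "T (- j) (T j \<phi>) = \<phi>" if "\<phi> \<in> K" for \<phi>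
      using T_add[OF that, of j "- j"] T_0[OF that] by (simp only: add.right_inverse)
    have "AE \<phi> in \<mu>. g (T (- j) \<phi>) = g \<phi>" using nat[of "nat (- j)"] False by simp
    from AE_dual_aut[OF \<alpha>_pow_auto[of j] this] K show ?thesis
      by eventually_elim (simp only: eq)
  qed
qed

text \<open>
  For the converse, the functions vanishing off an invariant set \<open>E\<close> form an invariant subspace.  It
  is closed because for \<open>h\<close> in it \<open>\<integral> \<bar>f\<bar>\<^sup>2\<close> over the complement of \<open>E\<close> is at most
  \<open>\<integral> \<bar>f - h\<bar>\<^sup>2\<close>.
\<close>

lemma closed_subspace_supported:
  assumes E[measurable]: "E \<in> sets \<mu>"
  shows "L2_closed_subspace \<mu>
    {L2_class \<mu> f | f. f \<in> square_integrable \<mu> \<and> (AE \<phi> in \<mu>. \<phi> \<notin> E \<longrightarrow> f \<phi> = 0)}"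
    (is "L2_closed_subspace \<mu> ?W")
  unfolding L2_closed_subspace_def
proof (intro conjI ballI allI impI)
  show "?W \<subseteq> L2 \<mu>" using L2_class_in_L2 by blast
  show "L2_zero \<mu> \<in> ?W"
    unfolding L2_zero_def by (intro CollectI exI[of _ "\<lambda>\<phi>. 0"]) (simp add: square_integrable_zero)
next
  fix F H assume "F \<in> ?W" "H \<in> ?W"
  then obtain f h where f: "f \<in> square_integrable \<mu>" "AE \<phi> in \<mu>. \<phi> \<notin> E \<longrightarrow> f \<phi> = 0" "F = L2_class \<mu> f"
    and h: "h \<in> square_integrable \<mu>" "AE \<phi> in \<mu>. \<phi> \<notin> E \<longrightarrow> h \<phi> = 0" "H = L2_class \<mu> h" by blast
  have "AE \<phi> in \<mu>. \<phi> \<notin> E \<longrightarrow> f \<phi> + h \<phi> = 0" using f(2) h(2) by eventually_elim simp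
  then show "L2_add \<mu> F H \<in> ?W"
    unfolding f(3) h(3) L2_add_class[OF f(1) h(1)] using square_integrable_add[OF f(1) h(1)] by blast
next
  fix c F assume "F \<in> ?W"
  then obtain f where f: "f \<in> square_integrable \<mu>" "AE \<phi> in \<mu>. \<phi> \<notin> E \<longrightarrow> f \<phi> = 0" "F = L2_class \<mu> f"
    by blast
  have "AE \<phi> in \<mu>. \<phi> \<notin> E \<longrightarrow> c * f \<phi> = 0" using f(2) by eventually_elim simp
  then show "L2_scale \<mu> c F \<in> ?W"
    unfolding f(3) L2_scale_class[OF f(1)] using square_integrable_scale[OF f(1)] by blast
next
  fix F assume "F \<in> L2 \<mu>" and lim: "\<forall>e>0. \<exists>H\<in>?W. L2_dist \<mu> F H < e"
  then obtain f where f: "f \<in> square_integrable \<mu>" "F = L2_class \<mu> f" using L2_cases by blast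
  have fm[measurable]: "f \<in> borel_measurable \<mu>" using f by (simp add: square_integrable_def)
  let ?r = "\<lambda>\<phi>. if \<phi> \<in> E then 0 else (cmod (f \<phi>))\<^sup>2"
  have r: "integrable \<mu> ?r"
    by (rule Bochner_Integration.integrable_bound[of \<mu> "\<lambda>\<phi>. (cmod (f \<phi>))\<^sup>2"])
       (use f(1) in \<open>auto simp: square_integrable_def\<close>)
  have "(\<integral>\<phi>. ?r \<phi> \<partial>\<mu>) \<le> 0 + e" if "e > 0" for e
  proof -
    have "sqrt e > 0" using that by simp
    then obtain H where H: "H \<in> ?W" "L2_dist \<mu> F H < sqrt e" using lim by blast
    then obtain h where h: "h \<in> square_integrable \<mu>" "AE \<phi> in \<mu>. \<phi> \<notin> E \<longrightarrow> h \<phi> = 0" "H = L2_class \<mu> h"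
      by blast
    have d: "integrable \<mu> (\<lambda>\<phi>. (cmod (f \<phi> - h \<phi>))\<^sup>2)"
      using square_integrable_diff[OF f(1) h(1)] by (simp add: square_integrable_def)
    have "AE \<phi> in \<mu>. ?r \<phi> \<le> (cmod (f \<phi> - h \<phi>))\<^sup>2" using h(2) by eventually_elim simp
    then have "(\<integral>\<phi>. ?r \<phi> \<partial>\<mu>) \<le> (\<integral>\<phi>. (cmod (f \<phi> - h \<phi>))\<^sup>2 \<partial>\<mu>)"
      by (rule integral_mono_AE[OF r d])
    moreover have "sqrt (\<integral>\<phi>. (cmod (f \<phi> - h \<phi>))\<^sup>2 \<partial>\<mu>) < sqrt e"
      using H(2) unfolding f(2) h(3) L2_dist_class[OF f(1) h(1)] .
    ultimately show ?thesis by simp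
  qed
  then have "(\<integral>\<phi>. ?r \<phi> \<partial>\<mu>) \<le> 0" by (rule field_le_epsilon)
  then have "(\<integral>\<phi>. ?r \<phi> \<partial>\<mu>) = 0" by (intro antisym integral_nonneg_AE) auto
  then have "AE \<phi> in \<mu>. ?r \<phi> = 0"
    by (subst (asm) integral_nonneg_eq_0_iff_AE[OF r]) auto
  then have "AE \<phi> in \<mu>. \<phi> \<notin> E \<longrightarrow> f \<phi> = 0" by eventually_elim (auto split: if_splits)
  then show "F \<in> ?W" using f by blast
qed

lemma irreducible_zero_one:
  assumes irr: "irreducible_rep_L2 G \<mu> (U_rep B \<alpha> \<mu>)" and E: "E \<in> sets \<mu>"
    and inv: "AE \<phi> in \<mu>. (dual_aut B \<alpha> \<phi> \<in> E) = (\<phi> \<in> E)"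
  shows "(AE \<phi> in \<mu>. \<phi> \<notin> E) \<or> (AE \<phi> in \<mu>. \<phi> \<in> E)"
proof -
  let ?W = "{L2_class \<mu> f | f. f \<in> square_integrable \<mu> \<and> (AE \<phi> in \<mu>. \<phi> \<notin> E \<longrightarrow> f \<phi> = 0)}"
  have "U_rep B \<alpha> \<mu> g ` ?W \<subseteq> ?W" if g: "g \<in> carrier G" for g
  proof
    fix F assume "F \<in> U_rep B \<alpha> \<mu> g ` ?W"
    then obtain f where f: "f \<in> square_integrable \<mu>" "AE \<phi> in \<mu>. \<phi> \<notin> E \<longrightarrow> f \<phi> = 0"
      "F = U_rep B \<alpha> \<mu> g (L2_class \<mu> f)" by blast
    obtain j b where g': "g = (j, b)" by (cases g)
    from AE_dual_aut[OF \<alpha>_pow_auto[of j] f(2)] AE_invariant_pow[OF inv, of j]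
    have "AE \<phi> in \<mu>. \<phi> \<notin> E \<longrightarrow> U g f \<phi> = 0"
      unfolding g' U_apply by eventually_elim simp
    then show "F \<in> ?W"
      using U_square_integrable[OF g f(1)] unfolding f(3) U_rep_class[OF g f(1)] by blast
  qed
  then have "?W = {L2_zero \<mu>} \<or> ?W = L2 \<mu>"
    using irr[unfolded irreducible_rep_L2_def, THEN conjunct2, THEN conjunct2, THEN spec, of ?W]
      closed_subspace_supported[OF E] by simp
  then show ?thesis
  proof
    assume W: "?W = {L2_zero \<mu>}"
    have "L2_class \<mu> (indicator E) \<in> ?W"
      by (intro CollectI exI[of _ "indicator E"]) (simp add: indicator_square_integrable E)
    then have "L2_class \<mu> (indicator E) = L2_zero \<mu>" unfolding W by simp
    then have "AE \<phi> in \<mu>. (indicator E \<phi> :: complex) = 0"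
      by (subst (asm) L2_class_eq_zero_iff) (simp_all add: indicator_square_integrable E)
    then have "AE \<phi> in \<mu>. \<phi> \<notin> E" by eventually_elim (simp add: indicator_def split: if_splits)
    then show ?thesis ..
  next
    assume W: "?W = L2 \<mu>"
    have one: "(\<lambda>\<phi>. 1) \<in> square_integrable \<mu>" by (rule square_integrable_bounded[of _ 1]) auto
    have "L2_class \<mu> (\<lambda>\<phi>. 1) \<in> ?W" unfolding W by (rule L2_class_in_L2[OF one])
    then obtain f where f: "f \<in> square_integrable \<mu>" "AE \<phi> in \<mu>. \<phi> \<notin> E \<longrightarrow> f \<phi> = 0"
      "L2_class \<mu> (\<lambda>\<phi>. 1) = L2_class \<mu> f" by blast
    have "AE \<phi> in \<mu>. 1 = f \<phi>" using f(3) L2_class_eq_iff[OF one f(1)] by simp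
    with f(2) have "AE \<phi> in \<mu>. \<phi> \<in> E" by eventually_elim auto
    then show ?thesis ..
  qed
qed

text \<open>
  The superlevel sets of the real and imaginary part of an invariant function are invariant, hence
  null or conull, which makes both parts constant.
\<close>

lemma irreducible_imp_ergodic:
  assumes irr: "irreducible_rep_L2 G \<mu> (U_rep B \<alpha> \<mu>)"
  shows "ergodic \<mu> (dual_aut B \<alpha>)"
  unfolding ergodic_def
proof (intro allI impI, elim conjE exE)
  fix f :: "('b \<Rightarrow> complex) \<Rightarrow> complex" and C
  assume fm[measurable]: "f \<in> borel_measurable \<mu>" and C: "AE \<phi> in \<mu>. cmod (f \<phi>) \<le> C"
    and inv: "AE \<phi> in \<mu>. f (dual_aut B \<alpha> \<phi>) = f \<phi>"
  have const: "\<exists>c. AE \<phi> in \<mu>. r (f \<phi>) = c"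
    if r[measurable]: "r \<in> borel_measurable borel" and le: "\<And>z. \<bar>r z\<bar> \<le> cmod z" for r :: "complex \<Rightarrow> real"
  proof -
    have "AE \<phi> in \<mu>. \<bar>r (f \<phi>)\<bar> \<le> C" using C by eventually_elim (rule order_trans[OF le])
    moreover have "(AE \<phi> in \<mu>. r (f \<phi>) \<le> a) \<or> (AE \<phi> in \<mu>. r (f \<phi>) > a)" for a
    proof -
      define E where "E = {\<phi>\<in>space \<mu>. r (f \<phi>) > a}"
      have E: "E \<in> sets \<mu>" unfolding E_def by measurable
      have K: "AE \<phi> in \<mu>. \<phi> \<in> K" by (rule AE_I2) simp
      from inv K have "AE \<phi> in \<mu>. (dual_aut B \<alpha> \<phi> \<in> E) = (\<phi> \<in> E)"
        by eventually_elim (simp add: E_def dual_aut_closed[OF \<alpha>_auto])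
      then have "(AE \<phi> in \<mu>. \<phi> \<notin> E) \<or> (AE \<phi> in \<mu>. \<phi> \<in> E)"
        by (rule irreducible_zero_one[OF irr E])
      then show ?thesis
      proof
        assume "AE \<phi> in \<mu>. \<phi> \<notin> E"
        with K have "AE \<phi> in \<mu>. r (f \<phi>) \<le> a" by eventually_elim (auto simp: E_def)
        then show ?thesis ..
      next
        assume "AE \<phi> in \<mu>. \<phi> \<in> E"
        then have "AE \<phi> in \<mu>. r (f \<phi>) > a" by eventually_elim (auto simp: E_def)
        then show ?thesis ..
      qed
    qed
    ultimately obtain c where "AE \<phi> in \<mu>. r (f \<phi>) = c"
      by (rule zero_one_constant[OF AE_nontrivial]) blast
    then show ?thesis ..
  qed
  obtain x where x: "AE \<phi> in \<mu>. Re (f \<phi>) = x" using const[of Re] abs_Re_le_cmod by auto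
  obtain y where y: "AE \<phi> in \<mu>. Im (f \<phi>) = y" using const[of Im] abs_Im_le_cmod by auto
  from x y have "AE \<phi> in \<mu>. f \<phi> = Complex x y" by eventually_elim (simp add: complex_eq_iff)
  then show "\<exists>c. AE \<phi> in \<mu>. f \<phi> = c" ..
qed

lemma irreducible_iff_ergodic:
  "irreducible_rep_L2 G \<mu> (U_rep B \<alpha> \<mu>) \<longleftrightarrow> ergodic \<mu> (dual_aut B \<alpha>)"
  using ergodic_imp_irreducible irreducible_imp_ergodic by blast

end


section \<open>Fourier coefficients and infinite orbits\<close>

context dual_haar
begin

text \<open>
  Vanishing Fourier coefficients give vanishing integrals against trigonometric polynomials, and in
  the limit over every Borel set.
\<close>

lemma fourier_uniqueness:
  assumes h: "integrable \<mu> h" and zero: "\<And>b. b \<in> carrier B \<Longrightarrow> (\<integral>\<phi>. \<phi> b * h \<phi> \<partial>\<mu>) = 0"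
  shows "AE \<phi> in \<mu>. (h \<phi> :: complex) = 0"
proof (rule density_zero[OF h])
  note [measurable] = borel_measurable_integrable[OF h]
  have bdd: "integrable \<mu> (\<lambda>\<phi>. p \<phi> * h \<phi>)"
    if "continuous_on K p" for p
  proof -
    have "bounded (p ` K)" by (intro compact_imp_bounded compact_continuous_image that compact_K)
    then obtain D where D: "\<And>\<phi>. \<phi> \<in> K \<Longrightarrow> cmod (p \<phi>) \<le> D" by (auto simp: bounded_iff)
    have [measurable]: "p \<in> borel_measurable \<mu>" by (rule continuous_on_measurable[OF that])
    have "integrable \<mu> (\<lambda>\<phi>. D * norm (h \<phi>))" using h by simp
    then show ?thesis
    proof (rule Bochner_Integration.integrable_bound)
      show "AE \<phi> in \<mu>. norm (p \<phi> * h \<phi>) \<le> norm (D * norm (h \<phi>))"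
      proof (rule AE_I2)
        fix \<phi> assume "\<phi> \<in> space \<mu>"
        then have "cmod (p \<phi>) * cmod (h \<phi>) \<le> D * cmod (h \<phi>)"
          by (intro mult_right_mono D) simp_all
        then show "norm (p \<phi> * h \<phi>) \<le> norm (D * norm (h \<phi>))"
          by (simp add: norm_mult)
      qed
    qed measurable
  qed
  have poly: "(\<integral>\<phi>. p \<phi> * h \<phi> \<partial>\<mu>) = 0" if "p \<in> trig_poly" for p
    using that
  proof induction
    case (add p q)
    then show ?case
      by (simp add: distrib_right bdd trig_poly_continuous)
  qed (simp_all add: zero mult.assoc)
  fix E assume E[measurable]: "E \<in> sets \<mu>"
  obtain p where p: "\<And>n. p n \<in> trig_poly" "\<And>n \<phi>. \<phi> \<in> K \<Longrightarrow> cmod (p n \<phi>) \<le> 1"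
    "AE \<phi> in \<mu>. (\<lambda>n. p n \<phi>) \<longlonglongrightarrow> indicator E \<phi>"
    by (rule indicator_trig_limit[OF E]) blast
  have [measurable]: "p n \<in> borel_measurable \<mu>" for n
    by (rule continuous_on_measurable[OF trig_poly_continuous[OF p(1)]])
  have "(\<lambda>n. \<integral>\<phi>. p n \<phi> * h \<phi> \<partial>\<mu>) \<longlonglongrightarrow> (\<integral>\<phi>. indicator E \<phi> * h \<phi> \<partial>\<mu>)"
  proof (rule integral_dominated_convergence[where w = "\<lambda>\<phi>. norm (h \<phi>)"])
    show "AE \<phi> in \<mu>. (\<lambda>n. p n \<phi> * h \<phi>) \<longlonglongrightarrow> indicator E \<phi> * h \<phi>"
      using p(3) by eventually_elim (intro tendsto_mult tendsto_const)
    show "AE \<phi> in \<mu>. norm (p n \<phi> * h \<phi>) \<le> norm (h \<phi>)" for n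
      by (rule AE_I2) (use p(2) in \<open>simp add: norm_mult mult_left_le_one_le\<close>)
  qed (use h in \<open>measurable, simp\<close>)
  then have "(\<integral>\<phi>. indicator E \<phi> * h \<phi> \<partial>\<mu>) = 0"
    by (simp add: poly[OF p(1)] LIMSEQ_const_iff)
  moreover have "(indicator E \<phi> :: complex) * h \<phi> = indicator E \<phi> *\<^sub>R h \<phi>" for \<phi>
    by (simp add: indicator_def)
  ultimately show "set_lebesgue_integral \<mu> E h = 0"
    by (simp add: set_lebesgue_integral_def)
qed

lemma character_orthonormal:
  assumes sep: "\<And>b. b \<in> carrier B \<Longrightarrow> b \<noteq> \<one> \<Longrightarrow> \<exists>\<kappa>\<in>K. \<kappa> b \<noteq> 1"
    and b: "b \<in> carrier B" and c: "c \<in> carrier B"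
  shows "(\<integral>\<phi>. \<phi> b * cnj (\<phi> c) \<partial>\<mu>) = (if b = c then 1 else 0)"
proof -
  have "(\<integral>\<phi>. \<phi> b * cnj (\<phi> c) \<partial>\<mu>) = (\<integral>\<phi>. \<phi> (b \<otimes> inv c) \<partial>\<mu>)"
    by (rule Bochner_Integration.integral_cong) (simp_all add: character_mult character_inv b c)
  also have "\<dots> = (if b = c then 1 else 0)"
  proof (cases "b = c")
    case True
    then show ?thesis using c by (simp add: integral_character_eq_1 character_one)
  next
    case False
    then have "b \<otimes> inv c \<noteq> \<one>"
      using b c by (metis inv_closed inv_equality inv_inv)
    then obtain \<kappa> where "\<kappa> \<in> K" "\<kappa> (b \<otimes> inv c) \<noteq> 1" using sep[of "b \<otimes> inv c"] b c by auto
    then show ?thesis using integral_character_eq_0[of "b \<otimes> inv c" \<kappa>] b c False by simp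
  qed
  finally show ?thesis .
qed

text \<open>
  Bessel's inequality for finitely many characters with the same coefficient \<open>c\<close>, obtained from
  \<open>\<integral> \<bar>f - c (\<Sum> cnj \<phi>(b))\<bar>\<^sup>2 \<ge> 0\<close>.
\<close>

lemma bessel_equal_coefficients:
  assumes sep: "\<And>b. b \<in> carrier B \<Longrightarrow> b \<noteq> \<one> \<Longrightarrow> \<exists>\<kappa>\<in>K. \<kappa> b \<noteq> 1"
    and f: "f \<in> square_integrable \<mu>" and F: "finite F" "F \<subseteq> carrier B"
    and c: "\<And>b. b \<in> F \<Longrightarrow> (\<integral>\<phi>. \<phi> b * f \<phi> \<partial>\<mu>) = c"
  shows "real (card F) * (cmod c)\<^sup>2 \<le> (\<integral>\<phi>. (cmod (f \<phi>))\<^sup>2 \<partial>\<mu>)"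
proof -
  define S where "S \<phi> = (\<Sum>b\<in>F. \<phi> b)" for \<phi> :: "'b \<Rightarrow> complex"
  have ev: "(\<lambda>\<phi>. \<phi> b) \<in> square_integrable \<mu>" if "b \<in> carrier B" for b
    by (rule square_integrable_bounded[of _ 1])
       (auto simp: character_norm that intro: continuous_on_measurable continuous_on_evaluation)
  have cev: "(\<lambda>\<phi>. cnj (\<phi> b)) \<in> square_integrable \<mu>" if "b \<in> carrier B" for b
    by (rule square_integrable_bounded[of _ 1])
       (auto simp: character_norm that intro!: continuous_on_measurable continuous_on_evaluation continuous_on_cnj)
  have i1: "integrable \<mu> (\<lambda>\<phi>. \<phi> b * f \<phi>)" if "b \<in> F" for b
    using integrable_mult_cnj[OF f cev, of b] that F by (auto simp: mult.commute)
  have i2: "integrable \<mu> (\<lambda>\<phi>. \<phi> b * cnj (\<phi> b'))" if "b \<in> F" "b' \<in> F" for b b'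
    using integrable_mult_cnj[OF ev ev, of b b'] that F by auto
  have fS: "(\<integral>\<phi>. S \<phi> * f \<phi> \<partial>\<mu>) = of_nat (card F) * c" "integrable \<mu> (\<lambda>\<phi>. S \<phi> * f \<phi>)"
    unfolding S_def sum_distrib_right by (simp_all add: i1 c)
  have SS: "(\<integral>\<phi>. S \<phi> * cnj (S \<phi>) \<partial>\<mu>) = of_nat (card F)" "integrable \<mu> (\<lambda>\<phi>. S \<phi> * cnj (S \<phi>))"
    unfolding S_def cnj_sum sum_product
    using F i2 character_orthonormal[OF sep] by (simp_all add: subset_iff)
  have f2: "integrable \<mu> (\<lambda>\<phi>. complex_of_real ((cmod (f \<phi>))\<^sup>2))"
    using f by (simp add: square_integrable_def del: of_real_power)
  have expand: "complex_of_real ((cmod (f \<phi> - c * cnj (S \<phi>)))\<^sup>2) =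
      of_real ((cmod (f \<phi>))\<^sup>2) - cnj c * (S \<phi> * f \<phi>) - c * cnj (S \<phi> * f \<phi>) + c * cnj c * (S \<phi> * cnj (S \<phi>))" for \<phi>
    unfolding complex_norm_square by (simp add: algebra_simps)
  have "complex_of_real (\<integral>\<phi>. (cmod (f \<phi> - c * cnj (S \<phi>)))\<^sup>2 \<partial>\<mu>) =
      (\<integral>\<phi>. of_real ((cmod (f \<phi>))\<^sup>2) - cnj c * (S \<phi> * f \<phi>) - c * cnj (S \<phi> * f \<phi>) + c * cnj c * (S \<phi> * cnj (S \<phi>)) \<partial>\<mu>)"
    unfolding integral_complex_of_real[symmetric] expand ..
  also have "\<dots> = (\<integral>\<phi>. complex_of_real ((cmod (f \<phi>))\<^sup>2) \<partial>\<mu>) - cnj c * (of_nat (card F) * c)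
      - c * cnj (of_nat (card F) * c) + c * cnj c * of_nat (card F)"
  proof -
    have i: "integrable \<mu> (\<lambda>\<phi>. cnj c * (S \<phi> * f \<phi>))" "integrable \<mu> (\<lambda>\<phi>. c * cnj (S \<phi> * f \<phi>))"
      "integrable \<mu> (\<lambda>\<phi>. c * cnj c * (S \<phi> * cnj (S \<phi>)))"
      by (intro integrable_mult_right integrable_cnj fS SS)+
    have e: "(\<integral>\<phi>. cnj c * (S \<phi> * f \<phi>) \<partial>\<mu>) = cnj c * (of_nat (card F) * c)"
      "(\<integral>\<phi>. c * cnj (S \<phi> * f \<phi>) \<partial>\<mu>) = c * cnj (of_nat (card F) * c)"
      "(\<integral>\<phi>. c * cnj c * (S \<phi> * cnj (S \<phi>)) \<partial>\<mu>) = c * cnj c * of_nat (card F)"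
      by (simp_all only: integral_mult_right_zero Bochner_Integration.integral_cnj fS SS)
    show ?thesis
      unfolding e[symmetric]
      by (subst Bochner_Integration.integral_add Bochner_Integration.integral_diff
            | intro Bochner_Integration.integrable_diff f2 i | rule refl)+
  qed
  also have "\<dots> = complex_of_real ((\<integral>\<phi>. (cmod (f \<phi>))\<^sup>2 \<partial>\<mu>) - real (card F) * (cmod c)\<^sup>2)"
    unfolding integral_complex_of_real of_real_diff of_real_mult complex_norm_square[of c]
    by (simp add: algebra_simps)
  finally have "(\<integral>\<phi>. (cmod (f \<phi>))\<^sup>2 \<partial>\<mu>) - real (card F) * (cmod c)\<^sup>2
      = (\<integral>\<phi>. (cmod (f \<phi> - c * cnj (S \<phi>)))\<^sup>2 \<partial>\<mu>)"
    by (simp only: of_real_eq_iff)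
  moreover have "\<dots> \<ge> 0" by (rule integral_nonneg_AE) simp
  ultimately show ?thesis by linarith
qed

end

context dual_system
begin

text \<open>
  The Fourier coefficients of an invariant function are constant along the orbits of \<open>\<alpha>\<close>, hence
  vanish on infinite orbits by Bessel's inequality.
\<close>

lemma ergodic_of_infinite_orbits:
  assumes sep: "\<And>b. b \<in> carrier B \<Longrightarrow> b \<noteq> \<one> \<Longrightarrow> \<exists>\<kappa>\<in>K. \<kappa> b \<noteq> 1"
    and orb: "\<And>b n. b \<in> carrier B \<Longrightarrow> b \<noteq> \<one> \<Longrightarrow> n > 0 \<Longrightarrow> \<alpha>_pow (int n) b \<noteq> b"
  shows "ergodic \<mu> (dual_aut B \<alpha>)"
  unfolding ergodic_def
proof (intro allI impI, elim conjE exE)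
  fix f :: "('b \<Rightarrow> complex) \<Rightarrow> complex" and C
  assume fm[measurable]: "f \<in> borel_measurable \<mu>" and C: "AE \<phi> in \<mu>. cmod (f \<phi>) \<le> C"
    and inv: "AE \<phi> in \<mu>. f (dual_aut B \<alpha> \<phi>) = f \<phi>"
  have f: "f \<in> square_integrable \<mu>" by (rule square_integrable_bounded[OF fm C])
  have fi: "integrable \<mu> f" by (rule integrable_const_bound[OF C fm])
  have evm[measurable]: "(\<lambda>\<phi>. \<phi> b) \<in> borel_measurable \<mu>" for b
    by (rule continuous_on_measurable[OF continuous_on_evaluation])
  have K: "AE \<phi> in \<mu>. \<phi> \<in> K" by (rule AE_I2) simp
  define c where "c b = (\<integral>\<phi>. \<phi> b * f \<phi> \<partial>\<mu>)" for b
  have c_pow: "c (\<alpha>_pow j b) = c b" if b: "b \<in> carrier B" for b j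
  proof -
    have "c b = (\<integral>\<phi>. T j \<phi> b * f (T j \<phi>) \<partial>\<mu>)"
      unfolding c_def
      by (rule integral_dual_aut[OF \<alpha>_pow_auto, of "\<lambda>\<phi>. \<phi> b * f \<phi>", symmetric]) measurable
    also have "\<dots> = (\<integral>\<phi>. \<phi> (\<alpha>_pow j b) * f \<phi> \<partial>\<mu>)"
    proof (rule integral_cong_AE)
      show "AE \<phi> in \<mu>. T j \<phi> b * f (T j \<phi>) = \<phi> (\<alpha>_pow j b) * f \<phi>"
        using AE_invariant_pow[OF inv, of j] K
        by eventually_elim (simp add: dual_aut_apply b)
      show "(\<lambda>\<phi>. T j \<phi> b * f (T j \<phi>)) \<in> borel_measurable \<mu>"
        by (rule measurable_compose[OF dual_aut_measurable[OF \<alpha>_pow_auto], of "\<lambda>\<phi>. \<phi> b * f \<phi>"]) measurable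
    qed measurable
    finally show ?thesis by (simp add: c_def)
  qed
  have c0: "c b = 0" if b: "b \<in> carrier B" "b \<noteq> \<one>" for b
  proof (rule ccontr)
    assume "c b \<noteq> 0"
    let ?o = "\<lambda>n. \<alpha>_pow (int n) b"
    have oc: "?o n \<in> carrier B" for n by (rule auto_closed[OF \<alpha>_pow_auto b(1)])
    have "?o m \<noteq> ?o n" if "m < n" for m n
    proof
      assume eq: "?o m = ?o n"
      have "?o n = \<alpha>_pow (int m) (\<alpha>_pow (int (n - m)) b)"
        using \<alpha>_pow_add[of "int m" "int (n - m)"] that b by (simp add: compose_eq)
      with eq have "\<alpha>_pow (int (n - m)) b = b"
        using auto_bij[OF \<alpha>_pow_auto[of "int m"]] b(1) oc
        unfolding bij_betw_def inj_on_def by metis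
      then show False using orb[OF b, of "n - m"] that by simp
    qed
    then have inj: "inj ?o" by (rule linorder_injI)
    have bessel: "real n * (cmod (c b))\<^sup>2 \<le> (\<integral>\<phi>. (cmod (f \<phi>))\<^sup>2 \<partial>\<mu>)" for n
    proof -
      have card: "card (?o ` {..<n}) = n"
        using inj by (simp add: card_image inj_on_subset)
      have "real (card (?o ` {..<n})) * (cmod (c b))\<^sup>2 \<le> (\<integral>\<phi>. (cmod (f \<phi>))\<^sup>2 \<partial>\<mu>)"
      proof (rule bessel_equal_coefficients[OF sep f])
        show "?o ` {..<n} \<subseteq> carrier B" using oc by blast
        show "(\<integral>\<phi>. \<phi> b' * f \<phi> \<partial>\<mu>) = c b" if "b' \<in> ?o ` {..<n}" for b'
          using that c_pow[OF b(1)] by (auto simp: c_def)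
      qed auto
      then show ?thesis by (simp only: card)
    qed
    have "0 < (cmod (c b))\<^sup>2" using \<open>c b \<noteq> 0\<close> by simp
    then obtain n where "(\<integral>\<phi>. (cmod (f \<phi>))\<^sup>2 \<partial>\<mu>) < real n * (cmod (c b))\<^sup>2"
      using reals_Archimedean3 by blast
    then show False using bessel[of n] by linarith
  qed
  have "AE \<phi> in \<mu>. f \<phi> - c \<one> = 0"
  proof (rule fourier_uniqueness)
    show "integrable \<mu> (\<lambda>\<phi>. f \<phi> - c \<one>)" using fi by simp
    fix b assume b: "b \<in> carrier B"
    have i: "integrable \<mu> (\<lambda>\<phi>. \<phi> b * f \<phi>)" "integrable \<mu> (\<lambda>\<phi>. \<phi> b)"
    proof -
      show "integrable \<mu> (\<lambda>\<phi>. \<phi> b)" by (rule integrable_continuous[OF continuous_on_evaluation])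
      show "integrable \<mu> (\<lambda>\<phi>. \<phi> b * f \<phi>)"
      proof (rule integrable_const_bound)
        show "AE \<phi> in \<mu>. norm (\<phi> b * f \<phi>) \<le> C"
          using C K by eventually_elim (simp add: norm_mult character_norm b)
      qed measurable
    qed
    have "(\<integral>\<phi>. \<phi> b * (f \<phi> - c \<one>) \<partial>\<mu>) = c b - (\<integral>\<phi>. \<phi> b \<partial>\<mu>) * c \<one>"
      unfolding right_diff_distrib c_def[of b] using i by simp
    also have "\<dots> = 0"
    proof (cases "b = \<one>")
      case True
      then show ?thesis using integral_character_eq_1[of \<one>] character_one by simp
    next
      case False
      then show ?thesis using sep[OF b False] integral_character_eq_0[OF b] c0[OF b] by auto
    qed
    finally show "(\<integral>\<phi>. \<phi> b * (f \<phi> - c \<one>) \<partial>\<mu>) = 0" .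
  qed
  then have "AE \<phi> in \<mu>. f \<phi> = c \<one>" by eventually_elim simp
  then show "\<exists>c. AE \<phi> in \<mu>. f \<phi> = c" ..
qed

end


section \<open>Expanding integer matrices\<close>

lemma matrix_vector_mult_sum:
  fixes N :: "'a::comm_ring_1^'n^'m"
  shows "N *v (\<Sum>i\<in>I. x i) = (\<Sum>i\<in>I. N *v x i)"
  by (induction I rule: infinite_finite_induct) (simp_all add: matrix_vector_right_distrib)

text \<open>
  The discrete Fourier transform of the orbit of \<open>v\<close>: with a primitive \<open>n\<close>-th root of unity \<open>\<eta>\<close>,
  each \<open>w\<^sub>m = (\<Sum>k<n. \<eta>\<^sup>m\<^sup>k N\<^sup>k v)\<close> satisfies \<open>N w\<^sub>m = \<eta>\<^sup>-\<^sup>m w\<^sub>m\<close>, and since the \<open>w\<^sub>m\<close> add up to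
  \<open>n v\<close>, not all of them vanish.
\<close>

lemma periodic_vector_eigenvalue:
  fixes N :: "complex^'n^'n"
  assumes per: "(((*v) N) ^^ n) v = v" and n: "n > 0" and v: "v \<noteq> 0"
  obtains l w where "w \<noteq> 0" "N *v w = l *s w" "cmod l = 1"
proof -
  define \<eta> where "\<eta> = exp (2 * of_real pi * \<i> / of_nat n)"
  have \<eta>k: "\<eta> ^ k = exp (2 * of_real pi * \<i> * of_nat k / of_nat n)" for k
    unfolding \<eta>_def by (simp add: exp_of_nat_mult[symmetric] mult_ac)
  have \<eta>n: "\<eta> ^ n = 1" using n by (simp add: \<eta>k exp_eq_1)
  have \<eta>0: "\<eta> \<noteq> 0" and norm\<eta>: "cmod \<eta> = 1" by (simp_all add: \<eta>_def)
  let ?f = "(*v) N"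
  define u where "u m k = (\<eta> ^ (m * k)) *s ((?f ^^ k) v)" for m k
  define w where "w m = (\<Sum>k<n. u m k)" for m
  have eig: "N *v w m = inverse (\<eta> ^ m) *s w m" for m
  proof -
    have step: "N *v u m k = inverse (\<eta> ^ m) *s u m (Suc k)" for k
      unfolding u_def vector_scalar_commute using \<eta>0
      by (simp add: vector_smult_assoc power_add field_simps)
    have "u m n = u m 0"
      unfolding u_def by (simp add: per mult.commute[of m] power_mult \<eta>n)
    then have shift: "(\<Sum>k<n. u m (Suc k)) = (\<Sum>k<n. u m k)"
      using sum.lessThan_Suc_shift[of "u m" n] sum.lessThan_Suc[of "u m" n] by simp
    have "N *v w m = (\<Sum>k<n. inverse (\<eta> ^ m) *s u m (Suc k))"
      unfolding w_def matrix_vector_mult_sum step ..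
    also have "\<dots> = inverse (\<eta> ^ m) *s (\<Sum>k<n. u m (Suc k))"
      by (simp add: vec.scale_sum_right)
    finally show ?thesis unfolding shift w_def .
  qed
  have "(\<Sum>m<n. w m) = (\<Sum>k<n. \<Sum>m<n. u m k)"
    unfolding w_def by (rule sum.swap)
  also have "\<dots> = (\<Sum>k<n. (\<Sum>m<n. (\<eta> ^ k) ^ m) *s ((?f ^^ k) v))"
    unfolding u_def vec.scale_sum_left by (simp add: power_mult[symmetric] mult.commute)
  also have "\<dots> = (\<Sum>k<n. if k = 0 then of_nat n *s v else 0)"
  proof (rule sum.cong)
    fix k assume k: "k \<in> {..<n}"
    show "(\<Sum>m<n. (\<eta> ^ k) ^ m) *s ((?f ^^ k) v) = (if k = 0 then of_nat n *s v else 0)"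
    proof (cases "k = 0")
      case False
      have "\<eta> ^ k \<noteq> 1"
        using complex_root_unity_eq_1[of n k] n k False by (auto simp: \<eta>k mult_ac dest: dvd_imp_le)
      then have "(\<Sum>m<n. (\<eta> ^ k) ^ m) = ((\<eta> ^ k) ^ n - 1) / (\<eta> ^ k - 1)"
        by (rule geometric_sum)
      also have "(\<eta> ^ k) ^ n = 1" by (metis \<eta>n power_mult mult.commute power_one)
      finally show ?thesis using False by simp
    qed simp
  qed simp
  also have "\<dots> = of_nat n *s v" using n by (simp add: sum.delta)
  finally have "(\<Sum>m<n. w m) = of_nat n *s v" .
  moreover have "of_nat n *s v \<noteq> 0" using n v by (simp add: vec.scale_eq_0_iff)
  ultimately obtain m where "w m \<noteq> 0" by (metis sum.neutral)
  then show thesis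
    using eig[of m] norm\<eta> by (intro that[of "w m" "inverse (\<eta> ^ m)"]) (auto simp: norm_inverse norm_power)
qed

lemma det_map_matrix_of_int: "det (map_matrix real_of_int A) = real_of_int (det A)"
  by (simp add: det_def)

lemma funpow_left_inverse:
  fixes f g :: "'a \<Rightarrow> 'a"
  assumes "\<And>x. g (f x) = x"
  shows "(g ^^ k) ((f ^^ k) x) = x"
proof (induction k)
  case (Suc k)
  have "(g ^^ Suc k) ((f ^^ Suc k) x) = (g ^^ k) (g (f ((f ^^ k) x)))"
    by (simp only: funpow_Suc_right[of k g] funpow.simps(2)[of k f] comp_apply)
  then show ?case by (simp only: assms Suc)
qed simp

locale nonsingular_int_matrix =
  fixes A :: "int^'n^'n"
  assumes det: "det A \<noteq> 0"
begin

abbreviation M :: "real^'n^'n" where "M \<equiv> map_matrix real_of_int A"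

abbreviation m :: "real^'n \<Rightarrow> real^'n" where "m \<equiv> (*v) M"

abbreviation m' :: "real^'n \<Rightarrow> real^'n" where "m' \<equiv> (*v) (matrix_inv M)"

abbreviation lattice :: "(real^'n) set" where "lattice \<equiv> {z. \<forall>i. z $ i \<in> \<int>}"

abbreviation \<Lambda> :: "(real^'n) monoid" where "\<Lambda> \<equiv> int_mat_localization A"

lemma invertible_M: "invertible M"
  using det by (simp add: invertible_det_nz det_map_matrix_of_int)

lemma m_m': "m (m' x) = x" and m'_m: "m' (m x) = x"
proof -
  have "M ** matrix_inv M = mat 1 \<and> matrix_inv M ** M = mat 1"
    unfolding matrix_inv_def by (rule someI_ex) (use invertible_M in \<open>simp add: invertible_def\<close>)
  then show "m (m' x) = x" "m' (m x) = x" by (simp_all add: matrix_vector_mul_assoc)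
qed

lemma m_pow_m'_pow: "(m ^^ k) ((m' ^^ k) x) = x"
  by (rule funpow_left_inverse) (rule m_m')

lemma m'_pow_m_pow: "(m' ^^ k) ((m ^^ k) x) = x"
  by (rule funpow_left_inverse) (rule m'_m)

lemma m_pow_add: "(m ^^ k) (x + y) = (m ^^ k) x + (m ^^ k) y"
  by (induction k) (simp_all add: matrix_vector_right_distrib)

lemma m_pow_minus: "(m ^^ k) (- x) = - (m ^^ k) x"
  by (induction k) (simp_all add: vec.neg)

lemma m_lattice: "x \<in> lattice \<Longrightarrow> m x \<in> lattice"
  by (auto simp: matrix_vector_mult_def intro!: Ints_sum Ints_mult)

lemma m_pow_lattice: "x \<in> lattice \<Longrightarrow> (m ^^ k) x \<in> lattice"
  by (induction k) (use m_lattice in auto)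

text \<open>
  In this form membership is stable under enlarging \<open>k\<close>, which brings two elements to a common
  exponent.
\<close>

lemma mem_\<Lambda>: "x \<in> carrier \<Lambda> \<longleftrightarrow> (\<exists>k. (m ^^ k) x \<in> lattice)"
proof
  assume "x \<in> carrier \<Lambda>"
  then obtain k z where "z \<in> lattice" "x = (m' ^^ k) z" by (auto simp: int_mat_localization_def)
  then show "\<exists>k. (m ^^ k) x \<in> lattice" by (intro exI[of _ k]) (simp only: m_pow_m'_pow)
next
  assume "\<exists>k. (m ^^ k) x \<in> lattice"
  then obtain k where "(m ^^ k) x \<in> lattice" ..
  then have "(m' ^^ k) ((m ^^ k) x) \<in> carrier \<Lambda>" unfolding int_mat_localization_def by auto
  then show "x \<in> carrier \<Lambda>" by (simp only: m'_pow_m_pow)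
qed

lemma \<Lambda>_add: "x \<in> carrier \<Lambda> \<Longrightarrow> y \<in> carrier \<Lambda> \<Longrightarrow> x + y \<in> carrier \<Lambda>"
proof -
  assume "x \<in> carrier \<Lambda>" "y \<in> carrier \<Lambda>"
  then obtain k l where k: "(m ^^ k) x \<in> lattice" and l: "(m ^^ l) y \<in> lattice" by (auto simp only: mem_\<Lambda>)
  have "(m ^^ (l + k)) x \<in> lattice" unfolding funpow_add comp_apply by (rule m_pow_lattice[OF k])
  moreover have "(m ^^ (k + l)) y \<in> lattice" unfolding funpow_add comp_apply by (rule m_pow_lattice[OF l])
  ultimately have "(m ^^ (k + l)) (x + y) \<in> lattice"
    unfolding m_pow_add by (simp add: add.commute)
  then show ?thesis unfolding mem_\<Lambda> ..
qed

lemma \<Lambda>_minus: "x \<in> carrier \<Lambda> \<Longrightarrow> - x \<in> carrier \<Lambda>"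
  unfolding mem_\<Lambda> m_pow_minus by auto

lemma \<Lambda>_zero: "0 \<in> carrier \<Lambda>"
  unfolding mem_\<Lambda> by (intro exI[of _ 0]) simp

lemma \<Lambda>_m: "x \<in> carrier \<Lambda> \<Longrightarrow> m x \<in> carrier \<Lambda>"
proof -
  assume "x \<in> carrier \<Lambda>"
  then obtain k where k: "(m ^^ k) x \<in> lattice" by (auto simp only: mem_\<Lambda>)
  have "(m ^^ k) (m x) \<in> lattice"
    using m_lattice[OF k] by (simp only: funpow_swap1)
  then show ?thesis unfolding mem_\<Lambda> ..
qed

lemma \<Lambda>_m': "x \<in> carrier \<Lambda> \<Longrightarrow> m' x \<in> carrier \<Lambda>"
proof -
  assume "x \<in> carrier \<Lambda>"
  then obtain k where k: "(m ^^ k) x \<in> lattice" by (auto simp only: mem_\<Lambda>)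
  have "(m ^^ Suc k) (m' x) \<in> lattice"
    using k by (simp only: funpow_Suc_right comp_apply m_m')
  then show ?thesis unfolding mem_\<Lambda> ..
qed

lemma \<Lambda>_simps: "x \<otimes>\<^bsub>\<Lambda>\<^esub> y = x + y" "\<one>\<^bsub>\<Lambda>\<^esub> = 0"
  by (simp_all add: int_mat_localization_def)

lemma comm_group_\<Lambda>: "comm_group \<Lambda>"
proof (rule comm_groupI)
  show "\<exists>y\<in>carrier \<Lambda>. y \<otimes>\<^bsub>\<Lambda>\<^esub> x = \<one>\<^bsub>\<Lambda>\<^esub>" if "x \<in> carrier \<Lambda>" for x
    using \<Lambda>_minus[OF that] by (intro bexI[of _ "- x"]) (simp_all add: \<Lambda>_simps)
qed (simp_all add: \<Lambda>_simps \<Lambda>_add \<Lambda>_zero add_ac)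

lemma int_mat_aut_auto: "int_mat_aut A \<in> auto \<Lambda>"
proof -
  have "bij_betw (int_mat_aut A) (carrier \<Lambda>) (carrier \<Lambda>)"
    by (rule bij_betw_byWitness[of _ m']) (auto simp: int_mat_aut_def m_m' m'_m \<Lambda>_m \<Lambda>_m')
  then show ?thesis
    by (auto simp: auto_def Bij_def hom_def int_mat_aut_def \<Lambda>_simps \<Lambda>_m \<Lambda>_add matrix_vector_right_distrib)
qed

text \<open>
  A real periodic vector stays periodic after complexification and would produce an eigenvalue on
  the unit circle.
\<close>

lemma no_periodic_points:
  assumes expanding: "\<And>l. complex_eigenvalue A l \<Longrightarrow> cmod l > 1"
    and n: "n > 0" and per: "(m ^^ n) b = b"
  shows "b = 0"
proof (rule ccontr)
  assume b: "b \<noteq> 0"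
  let ?N = "map_matrix of_int A :: complex^'n^'n"
  define cx where "cx x = (\<chi> i. complex_of_real (x $ i))" for x :: "real^'n"
  have "?N *v cx x = cx (m x)" for x
    by (simp add: cx_def matrix_vector_mult_def vec_eq_iff)
  then have "(((*v) ?N) ^^ k) (cx x) = cx ((m ^^ k) x)" for k x
    by (induction k) simp_all
  then have "(((*v) ?N) ^^ n) (cx b) = cx b" by (simp only: per)
  moreover have "cx b \<noteq> 0" using b by (auto simp: cx_def vec_eq_iff)
  ultimately obtain l w where "w \<noteq> 0" "?N *v w = l *s w" "cmod l = 1"
    using periodic_vector_eigenvalue[of n ?N "cx b"] n by blast
  then show False using expanding[of l] by (auto simp: complex_eigenvalue_def)
qed

lemma character_separates:
  assumes b: "b \<in> carrier \<Lambda>" "b \<noteq> 0"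
  shows "\<exists>\<kappa>\<in>carrier (dual_group \<Lambda>). \<kappa> b \<noteq> 1"
proof -
  interpret discrete_dual \<Lambda> using comm_group_\<Lambda> by (simp add: discrete_dual_def)
  obtain i where i: "b $ i \<noteq> 0" using b(2) by (auto simp: vec_eq_iff)
  \<comment> \<open>The frequency is chosen so that \<open>b\<close> is sent to \<open>cis pi = -1\<close>.\<close>
  let ?\<kappa> = "\<lambda>x\<in>carrier \<Lambda>. cis (pi * x $ i / b $ i)"
  have "?\<kappa> \<in> carrier (dual_group \<Lambda>)"
    by (auto simp: mem_K \<Lambda>_simps \<Lambda>_add cis_mult add_divide_distrib distrib_left)
  moreover have "?\<kappa> b \<noteq> 1" using b i by simp
  ultimately show ?thesis by blast
qed

lemma irreducible_\<Lambda>: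
  assumes expanding: "\<And>l. complex_eigenvalue A l \<Longrightarrow> cmod l > 1"
    and haar: "normalized_haar_measure (dual_group \<Lambda>) \<nu>"
  shows "irreducible_rep_L2 (semidirect_int \<Lambda> (int_mat_aut A)) \<nu> (U_rep \<Lambda> (int_mat_aut A) \<nu>)"
proof -
  interpret dual_system \<Lambda> \<nu> "int_mat_aut A"
    using comm_group_\<Lambda> haar int_mat_aut_auto
    by (simp add: dual_system_def dual_haar_def dual_haar_axioms_def discrete_dual_def dual_system_axioms_def)
  have pow: "\<alpha>_pow (int n) b = (m ^^ n) b" if b: "b \<in> carrier \<Lambda>" for n b
  proof (induction n)
    case 0
    show ?case using b by (simp add: AutoGroup_one)
  next
    case (Suc n)
    have c: "(m ^^ n) b \<in> carrier \<Lambda>" using b by (induction n) (simp_all add: \<Lambda>_m)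
    have "\<alpha>_pow (int (Suc n)) b = int_mat_aut A (\<alpha>_pow (int n) b)"
      using fun_cong[OF \<alpha>_pow_add[of 1 "int n"], of b] b by (simp only: of_nat_Suc \<alpha>_pow_1 compose_eq)
    also have "\<dots> = int_mat_aut A ((m ^^ n) b)" by (simp only: Suc)
    also have "\<dots> = (m ^^ Suc n) b" using c by (simp add: int_mat_aut_def)
    finally show ?case .
  qed
  have "ergodic \<nu> (dual_aut \<Lambda> (int_mat_aut A))"
  proof (rule ergodic_of_infinite_orbits)
    show "\<exists>\<kappa>\<in>K. \<kappa> b \<noteq> 1" if "b \<in> carrier \<Lambda>" "b \<noteq> \<one>\<^bsub>\<Lambda>\<^esub>" for b
      using character_separates that by (simp add: \<Lambda>_simps)
    show "\<alpha>_pow (int n) b \<noteq> b" if "b \<in> carrier \<Lambda>" "b \<noteq> \<one>\<^bsub>\<Lambda>\<^esub>" "n > 0" for b n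
      using no_periodic_points[OF expanding that(3)] that by (auto simp: pow \<Lambda>_simps)
  qed
  then show ?thesis by (rule ergodic_imp_irreducible)
qed

end


section \<open>Irreducibility of the representation\<close>

theorem theorem5p5:
  fixes B :: "('b, 'm) monoid_scheme" and \<alpha> :: "'b \<Rightarrow> 'b" and \<mu> :: "('b \<Rightarrow> complex) measure"
    and A :: "int^'n^'n" and \<nu> :: "(real^'n \<Rightarrow> complex) measure"
  shows
    "(comm_group B \<and> \<alpha> \<in> auto B \<and> normalized_haar_measure (dual_group B) \<mu> \<longrightarrow>
        (\<forall>g\<in>carrier (semidirect_int B \<alpha>). \<forall>(f, f')\<in>L2_rel \<mu>.
            (U_fun B \<alpha> g f, U_fun B \<alpha> g f') \<in> L2_rel \<mu>) \<and>
        unitary_rep_L2 (semidirect_int B \<alpha>) \<mu> (U_rep B \<alpha> \<mu>) \<and>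
        (irreducible_rep_L2 (semidirect_int B \<alpha>) \<mu> (U_rep B \<alpha> \<mu>)
           \<longleftrightarrow> ergodic \<mu> (dual_aut B \<alpha>)))
     \<and>
     (det A \<noteq> 0 \<and> (\<forall>l. complex_eigenvalue A l \<longrightarrow> cmod l > 1) \<longrightarrow>
        comm_group (int_mat_localization A) \<and>
        int_mat_aut A \<in> auto (int_mat_localization A) \<and>
        (normalized_haar_measure (dual_group (int_mat_localization A)) \<nu> \<longrightarrow>
           irreducible_rep_L2 (semidirect_int (int_mat_localization A) (int_mat_aut A)) \<nu>
             (U_rep (int_mat_localization A) (int_mat_aut A) \<nu>)))"
proof (intro conjI[of "_ \<longrightarrow> _" "_ \<longrightarrow> _"] impI; elim conjE)
  assume "comm_group B" "\<alpha> \<in> auto B" "normalized_haar_measure (dual_group B) \<mu>"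
  then interpret dual_system B \<mu> \<alpha>
    by (simp add: dual_system_def dual_haar_def dual_haar_axioms_def discrete_dual_def dual_system_axioms_def)
  show "(\<forall>g\<in>carrier (semidirect_int B \<alpha>). \<forall>(f, f')\<in>L2_rel \<mu>.
            (U_fun B \<alpha> g f, U_fun B \<alpha> g f') \<in> L2_rel \<mu>) \<and>
        unitary_rep_L2 (semidirect_int B \<alpha>) \<mu> (U_rep B \<alpha> \<mu>) \<and>
        (irreducible_rep_L2 (semidirect_int B \<alpha>) \<mu> (U_rep B \<alpha> \<mu>)
           \<longleftrightarrow> ergodic \<mu> (dual_aut B \<alpha>))"
    using U_L2_rel U_rep_unitary_rep irreducible_iff_ergodic by blast
next
  assume "det A \<noteq> 0" and expanding: "\<forall>l. complex_eigenvalue A l \<longrightarrow> cmod l > 1"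
  then interpret nonsingular_int_matrix A by unfold_locales
  show "comm_group (int_mat_localization A) \<and>
        int_mat_aut A \<in> auto (int_mat_localization A) \<and>
        (normalized_haar_measure (dual_group (int_mat_localization A)) \<nu> \<longrightarrow>
           irreducible_rep_L2 (semidirect_int (int_mat_localization A) (int_mat_aut A)) \<nu>
             (U_rep (int_mat_localization A) (int_mat_aut A) \<nu>))"
    using comm_group_\<Lambda> int_mat_aut_auto irreducible_\<Lambda> expanding by blast
qed

end
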